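(* Let $G$ be a finite graph that contains no triangle ($K_3$) as an induced subgraph and contains no induced subgraph that is a subdivision of $K_4$. Then $\chi(G)\leq 4$.
   Context: A subdivision of a graph is obtained by replacing its edges by paths of arbitrary length (at least one), with pairwise internally disjoint paths. $\chi(G)$ denotes the chromatic number of $G$. *)

theory Defs
  imports "Graph_Theory.Graph_Theory"
begin

text \<open>
  A finite simple graph is a \<^locale>\<open>pair_graph\<close>: a finite set of vertices together with a
  symmetric, irreflexive set of pairs, each undirected edge being represented by its two
  orientations. Subdivisions are those of \<^theory>\<open>Graph_Theory.Subdivision\<close>: repeatedly,
  an edge $uv$ is replaced by a path $u, w, v$ through a new vertex $w$ (zero repetitions being
  allowed), so that altogether the edges are replaced by pairwise internally disjoint paths of
  arbitrary length at least one. The original and the subdivided graph have the same vertex type,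
  the branch vertices keeping their names; \<open>K\<^bsub>4\<^esub> K\<close> allows every four-element vertex
  set, so nothing is lost by this.
\<close>

definition proper_colouring :: "'a pair_pre_digraph \<Rightarrow> nat \<Rightarrow> ('a \<Rightarrow> nat) \<Rightarrow> bool" where
  "proper_colouring G k c \<longleftrightarrow>
     c ` pverts G \<subseteq> {..<k} \<and> (\<forall>(u, v) \<in> parcs G. c u \<noteq> c v)"

text \<open>For a finite loop-free graph the minimum below is over a nonempty set.\<close>

definition chromatic_number :: "'a pair_pre_digraph \<Rightarrow> nat" where
  "chromatic_number G = (LEAST k. \<exists>c. proper_colouring G k c)"

lemma (in pair_graph) ex_proper_colouring: "\<exists>c. proper_colouring G (card (pverts G)) c"
proof -
  obtain c where c: "bij_betw c (pverts G) {0..<card (pverts G)}"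
    using ex_bij_betw_finite_nat[OF pair_finite_verts] by blast
  have "c u \<noteq> c v" if "(u, v) \<in> parcs G" for u v
    using bij_betw_imp_inj_on[OF c] in_arcsD1[OF that] in_arcsD2[OF that] no_loops'[OF that]
    by (meson inj_on_eq_iff)
  moreover have "c ` pverts G \<subseteq> {..<card (pverts G)}"
    using bij_betw_imp_surj_on[OF c] by (simp only: lessThan_atLeast0 order_refl)
  ultimately show ?thesis
    unfolding proper_colouring_def by blast
qed

lemma (in pair_graph) chromatic_number_le_iff:
  "chromatic_number G \<le> k \<longleftrightarrow> (\<exists>c. proper_colouring G k c)"
proof
  have "\<exists>c. proper_colouring G (chromatic_number G) c"
    unfolding chromatic_number_def
    by (rule LeastI[where P = "\<lambda>k. \<exists>c. proper_colouring G k c", OF ex_proper_colouring])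
  then obtain c where c: "proper_colouring G (chromatic_number G) c" ..
  assume le: "chromatic_number G \<le> k"
  have "c ` pverts G \<subseteq> {..<k}"
    using c le unfolding proper_colouring_def by (meson lessThan_subset_iff order_trans)
  with c have "proper_colouring G k c"
    unfolding proper_colouring_def by (elim conjE) (intro conjI)
  then show "\<exists>c. proper_colouring G k c"
    by (intro exI[where x = c])
next
  assume "\<exists>c. proper_colouring G k c"
  then show "chromatic_number G \<le> k"
    unfolding chromatic_number_def
    by (rule Least_le[where P = "\<lambda>k. \<exists>c. proper_colouring G k c"])
qed

end

theory Submission
  imports Defs
begin

text \<open>
  Split every component into the distance layers $N_k$ from a root. It suffices that each layer is
  bipartite: two colours for the even layers and two for the odd ones then colour $G$. As there are
  no triangles, it is enough that a layer contains no induced cycle of length at least five.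

  An induced cycle together with a connected set in which exactly three cycle vertices have a
  neighbour, one each, contains an induced subdivision of $K_4$. Let $C$ be an induced cycle of
  length at least five in $N_k$, and call the neighbours in $N_{k-1}$ of a vertex its parents. Any
  parents are joined through $N_0 \cup \dots \cup N_{k-2}$, which sends no edges to $C$. Hence some
  parent $v$ has two neighbours on $C$, and a shortest arc of $C$ whose ends have a common parent is
  of the form $a_1, s, a_2$. Let $x, a_1, s, a_2, y$ be consecutive on $C$. The square
  $v, a_1, s, a_2$ shows that a parent $w$ of $s$ is adjacent to neither $x$ nor $y$, that parents
  $q$ of $y$ are adjacent to $a_1$ and that parents $p$ of $x$ are adjacent to $a_2$. The cycle
  $q, a_1, s, a_2, y$ with $w$ attached at $s$ and $p$ attached at $a_2$ then yields the
  contradiction.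
\<close>

section \<open>Arcs of a path\<close>

text \<open>Both orientations of each step are collected, so that the result can be equated with the
  restriction of a symmetric relation and is invariant under reversal of the list.\<close>

fun path_arcs :: "'a list \<Rightarrow> ('a \<times> 'a) set" where
  "path_arcs (x # y # zs) = {(x, y), (y, x)} \<union> path_arcs (y # zs)"
| "path_arcs _ = {}"

lemma path_arcs_subset: "path_arcs xs \<subseteq> set xs \<times> set xs"
  by (induction xs rule: path_arcs.induct) auto

lemma path_arcs_append:
  assumes "xs \<noteq> []" "ys \<noteq> []"
  shows "path_arcs (xs @ ys)
    = path_arcs xs \<union> path_arcs ys \<union> {(last xs, hd ys), (hd ys, last xs)}"
  using assms
proof (induction xs rule: path_arcs.induct)
  case ("2_2" x) then show ?case by (cases ys) auto
qed auto

lemma path_arcs_append_Cons: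
  "path_arcs (xs @ y # ys) = path_arcs (xs @ [y]) \<union> path_arcs (y # ys)"
proof (induction xs rule: path_arcs.induct)
  case ("2_2" x) then show ?case by auto
qed auto

lemma path_arcs_rev [simp]: "path_arcs (rev xs) = path_arcs xs"
proof (induction xs)
  case (Cons x xs)
  then show ?case
    by (cases "xs = []") (auto simp: path_arcs_append last_rev neq_Nil_conv)
qed simp

lemma path_arcs_Cons: "xs \<noteq> [] \<Longrightarrow> path_arcs (x # xs) = {(x, hd xs), (hd xs, x)} \<union> path_arcs xs"
  by (cases xs) auto

lemma set_subset_Field_path_arcs:
  "2 \<le> length xs \<Longrightarrow> set xs \<subseteq> Field (path_arcs xs)"
proof (induction xs rule: path_arcs.induct)
  case (1 x y zs)
  then show ?case
    by (cases zs) (auto simp: Field_def)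
qed auto

text \<open>If the interior is nonempty, every arc of the path meets it. Thus expanding an edge into
  a path creates no arc between old vertices apart from that edge itself.\<close>

lemma path_arcs_ends:
  assumes "(x, y) \<in> path_arcs (a # I @ [b])" "x \<notin> set I" "y \<notin> set I" "distinct (a # I @ [b])"
  shows "{x, y} = {a, b}"
proof (cases "I = []")
  case False
  then have "path_arcs (a # I @ [b]) = {(a, hd I), (hd I, a), (last I, b), (b, last I)} \<union> path_arcs I"
    by (simp add: path_arcs_Cons path_arcs_append insert_commute Un_commute)
  then show ?thesis
    using assms False path_arcs_subset[of I] by auto
qed (use assms in auto)

section \<open>Subdivisions of the complete graph on four vertices\<close>

text \<open>Induction on the interior: one subdivision step puts its first vertex \<open>x\<close>
  on the edge \<open>ab\<close>; the finished edge \<open>ax\<close> then moves into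
  \<open>B\<close>, and the edge \<open>xb\<close> is expanded in the same way.\<close>

lemma subdivision_pair_path:
  assumes "subdivision_pair K \<lparr>pverts = S, parcs = B \<union> {(a, b), (b, a)}\<rparr>"
    and "(a, b) \<notin> B" "(b, a) \<notin> B" "B \<subseteq> S \<times> S" "a \<in> S" "b \<in> S" "a \<noteq> b"
    and "distinct I" "set I \<inter> S = {}"
  shows "subdivision_pair K \<lparr>pverts = S \<union> set I, parcs = B \<union> path_arcs (a # I @ [b])\<rparr>"
  using assms
proof (induction I arbitrary: a S B)
  case Nil
  then show ?case by simp
next
  case (Cons x I)
  let ?H = "\<lparr>pverts = S, parcs = B \<union> {(a, b), (b, a)}\<rparr>"
  have x: "x \<notin> S" "x \<noteq> a" "x \<noteq> b" using Cons.prems by auto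
  have eq: "subdivide ?H (a, b) x
      = \<lparr>pverts = insert x S, parcs = (B \<union> {(a, x), (x, a)}) \<union> {(x, b), (b, x)}\<rparr>"
    using Cons.prems(2,3) by (auto simp: subdivide.simps)
  have "subdivision_pair K (subdivide ?H (a, b) x)"
    by (rule subdivision_pair_divide) (use Cons.prems x in auto)
  then have "subdivision_pair K
      \<lparr>pverts = insert x S, parcs = (B \<union> {(a, x), (x, a)}) \<union> {(x, b), (b, x)}\<rparr>"
    by (simp only: eq)
  then have "subdivision_pair K \<lparr>pverts = insert x S \<union> set I,
      parcs = (B \<union> {(a, x), (x, a)}) \<union> path_arcs (x # I @ [b])\<rparr>"
    by (rule Cons.IH) (use Cons.prems x in auto)
  then show ?case by (simp add: insert_commute Un_assoc)
qed

lemma subdivision_pair_paths: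
  assumes "subdivision_pair K \<lparr>pverts = S, parcs = B \<union> (\<Union>(a, I, b)\<in>set ps. path_arcs [a, b])\<rparr>"
    and "B \<subseteq> S \<times> S"
    and "\<forall>(a, I, b)\<in>set ps. a \<in> S \<and> b \<in> S \<and> a \<noteq> b \<and> (a, b) \<notin> B \<and> (b, a) \<notin> B"
    and "distinct (map (\<lambda>(a, I, b). {a, b}) ps)"
    and "distinct (concat (map (\<lambda>(a, I, b). I) ps))"
    and "set (concat (map (\<lambda>(a, I, b). I) ps)) \<inter> S = {}"
  shows "subdivision_pair K \<lparr>pverts = S \<union> set (concat (map (\<lambda>(a, I, b). I) ps)),
      parcs = B \<union> (\<Union>(a, I, b)\<in>set ps. path_arcs (a # I @ [b]))\<rparr>"
  using assms
proof (induction ps arbitrary: S B)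
  case Nil
  then show ?case by simp
next
  case (Cons p ps)
  obtain a I b where p: "p = (a, I, b)" by (cases p)
  \<comment> \<open>\<open>R\<close> holds the edges still waiting to be expanded. They count as
    fixed arcs while \<open>ab\<close> is expanded; afterwards the new path joins \<open>B\<close>
    and the induction hypothesis deals with \<open>R\<close>.\<close>
  define R where "R = (\<Union>(a, I, b)\<in>set ps. path_arcs [a, b])"
  have ab: "a \<in> S" "b \<in> S" "a \<noteq> b" "(a, b) \<notin> B" "(b, a) \<notin> B" "distinct I" "set I \<inter> S = {}"
    using Cons.prems(3,5,6) by (auto simp: p)
  have rest: "c \<in> S \<and> d \<in> S \<and> c \<noteq> d \<and> (c, d) \<notin> B \<and> (d, c) \<notin> B" if "(c, J, d) \<in> set ps" for c J d
    using Cons.prems(3) that by auto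
  have pairs: "{c, d} \<noteq> {a, b}" if "(c, J, d) \<in> set ps" for c J d
  proof -
    have "{c, d} \<in> (\<lambda>(a, I, b). {a, b}) ` set ps"
      using that by (rule rev_image_eqI) simp
    moreover have "{a, b} \<notin> (\<lambda>(a, I, b). {a, b}) ` set ps"
      using Cons.prems(4) by (simp add: p)
    ultimately show ?thesis by metis
  qed
  have eq: "B \<union> (\<Union>(a, I, b)\<in>set (p # ps). path_arcs [a, b]) = (B \<union> R) \<union> {(a, b), (b, a)}"
    by (auto simp: p R_def)
  have R: "(c, d) \<in> R \<Longrightarrow> \<exists>J. (c, J, d) \<in> set ps \<or> (d, J, c) \<in> set ps" for c d
    by (auto simp: R_def)
  have notR: "(a, b) \<notin> R" "(b, a) \<notin> R"
    using R[of a b] R[of b a] pairs[of a _ b] pairs[of b _ a] by (auto simp: insert_commute)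
  have "subdivision_pair K \<lparr>pverts = S \<union> set I, parcs = (B \<union> R) \<union> path_arcs (a # I @ [b])\<rparr>"
  proof (rule subdivision_pair_path)
    show "subdivision_pair K \<lparr>pverts = S, parcs = (B \<union> R) \<union> {(a, b), (b, a)}\<rparr>"
      using Cons.prems(1) by (simp only: eq)
    show "(a, b) \<notin> B \<union> R" "(b, a) \<notin> B \<union> R"
      using ab notR by simp_all
    show "B \<union> R \<subseteq> S \<times> S" using Cons.prems(2) by (auto dest!: R dest: rest)
  qed (use ab in auto)
  then have 1: "subdivision_pair K
      \<lparr>pverts = S \<union> set I, parcs = (B \<union> path_arcs (a # I @ [b])) \<union> R\<rparr>"
    by (simp only: Un_ac)
  have 2: "(c, d) \<notin> path_arcs (a # I @ [b])" "(d, c) \<notin> path_arcs (a # I @ [b])"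
    if "(c, J, d) \<in> set ps" for c J d
  proof -
    have "c \<notin> set I" "d \<notin> set I" "distinct (a # I @ [b])" using rest[OF that] ab by auto
    then show "(c, d) \<notin> path_arcs (a # I @ [b])" "(d, c) \<notin> path_arcs (a # I @ [b])"
      using path_arcs_ends[of c d a I b] path_arcs_ends[of d c a I b] pairs[OF that] by blast+
  qed
  have "subdivision_pair K
      \<lparr>pverts = (S \<union> set I) \<union> set (concat (map (\<lambda>(a, I, b). I) ps)),
       parcs = (B \<union> path_arcs (a # I @ [b])) \<union> (\<Union>(a, I, b)\<in>set ps. path_arcs (a # I @ [b]))\<rparr>"
  proof (rule Cons.IH[OF 1[unfolded R_def]])
    show "B \<union> path_arcs (a # I @ [b]) \<subseteq> (S \<union> set I) \<times> (S \<union> set I)"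
      using Cons.prems(2) path_arcs_subset[of "a # I @ [b]"] ab by auto
    show "\<forall>(c, J, d)\<in>set ps. c \<in> S \<union> set I \<and> d \<in> S \<union> set I \<and> c \<noteq> d
        \<and> (c, d) \<notin> B \<union> path_arcs (a # I @ [b]) \<and> (d, c) \<notin> B \<union> path_arcs (a # I @ [b])"
      using rest 2 by blast
    show "set (concat (map (\<lambda>(a, I, b). I) ps)) \<inter> (S \<union> set I) = {}"
      using Cons.prems(5,6)
      unfolding p list.map concat.simps prod.case set_append distinct_append by blast
  qed (use Cons.prems in \<open>auto simp: p\<close>)
  then show ?case by (simp add: p Un_assoc)
qed

text \<open>Only the arc relation is mentioned, because the whole argument up to the final theorem
  works with a bare symmetric relation. \<open>Field A\<close> can replace the vertex set since
  every vertex of a subdivision of $K_4$ has a neighbour.\<close>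

definition has_isk4 :: "('a \<times> 'a) set \<Rightarrow> bool" where
  "has_isk4 A \<longleftrightarrow> (\<exists>K H. K\<^bsub>4\<^esub> (with_proj K) \<and> subdivision_pair K H
     \<and> pverts H \<subseteq> Field A \<and> parcs H = Restr A (pverts H))"

text \<open>The branch vertices are \<open>a\<close>, \<open>b\<close>, \<open>c\<close>,
  \<open>d\<close>, and the lists are the interiors of the paths for \<open>ab\<close>,
  \<open>ac\<close>, \<open>ad\<close>, \<open>bc\<close>, \<open>bd\<close>, \<open>cd\<close> in
  this order. The complete graph on these very vertices is the \<open>K\<close> that gets
  subdivided.\<close>

lemma has_isk4I:
  assumes dist: "distinct ([a, b, c, d] @ I1 @ I2 @ I3 @ I4 @ I5 @ I6)"
    and S: "S = set ([a, b, c, d] @ I1 @ I2 @ I3 @ I4 @ I5 @ I6)"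
    and arcs: "Restr A S = path_arcs (a # I1 @ [b]) \<union> path_arcs (a # I2 @ [c])
       \<union> path_arcs (a # I3 @ [d]) \<union> path_arcs (b # I4 @ [c]) \<union> path_arcs (b # I5 @ [d])
       \<union> path_arcs (c # I6 @ [d])"
  shows "has_isk4 A"
proof -
  define K where "K = \<lparr>pverts = {a, b, c, d}, parcs = {(x, y). x \<in> {a, b, c, d} \<and> y \<in> {a, b, c, d} \<and> x \<noteq> y}\<rparr>"
  have K4: "K\<^bsub>4\<^esub> (with_proj K)"
    unfolding complete_digraph_pair_def K_def using dist by auto
  then interpret graph "with_proj K" by (simp add: complete_digraph_def)
  have "pair_bidirected_digraph K"
    by unfold_locales (auto simp: K_def symmetric_conv arcs_ends_def arc_to_ends_def)
  then have "subdivision_pair K K" by (rule subdivision_pair_base)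
  let ?ps = "[(a, I1, b), (a, I2, c), (a, I3, d), (b, I4, c), (b, I5, d), (c, I6, d)]"
  have K: "K = \<lparr>pverts = {a, b, c, d}, parcs = {} \<union> (\<Union>(a, I, b)\<in>set ?ps. path_arcs [a, b])\<rparr>"
    using dist by (auto simp: K_def)
  have "subdivision_pair K \<lparr>pverts = {a, b, c, d} \<union> set (concat (map (\<lambda>(a, I, b). I) ?ps)),
      parcs = {} \<union> (\<Union>(a, I, b)\<in>set ?ps. path_arcs (a # I @ [b]))\<rparr>"
    by (rule subdivision_pair_paths, fold K, fact)
       (use dist in \<open>auto simp: doubleton_eq_iff\<close>)
  moreover have "{a, b, c, d} \<union> set (concat (map (\<lambda>(a, I, b). I) ?ps)) = S"
    using S by auto
  moreover have "{} \<union> (\<Union>(a, I, b)\<in>set ?ps. path_arcs (a # I @ [b])) = Restr A S"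
    unfolding arcs by auto
  ultimately have sd: "subdivision_pair K \<lparr>pverts = S, parcs = Restr A S\<rparr>"
    by (simp only:)
  \<comment> \<open>Every vertex of \<open>S\<close> lies on one of the six paths, and each of these
    has an arc; this puts \<open>S\<close> into the field.\<close>
  have fld: "set (x # I @ [y]) \<subseteq> Field (Restr A S)" if "path_arcs (x # I @ [y]) \<subseteq> Restr A S" for x y I
    using set_subset_Field_path_arcs[of "x # I @ [y]"] mono_Field[OF that] by auto
  have "path_arcs (a # I1 @ [b]) \<subseteq> Restr A S" "path_arcs (a # I2 @ [c]) \<subseteq> Restr A S" "path_arcs (a # I3 @ [d]) \<subseteq> Restr A S"
    "path_arcs (b # I4 @ [c]) \<subseteq> Restr A S" "path_arcs (b # I5 @ [d]) \<subseteq> Restr A S" "path_arcs (c # I6 @ [d]) \<subseteq> Restr A S"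
    using arcs by auto
  from this[THEN fld] have "S \<subseteq> Field (Restr A S)" unfolding S by auto
  also have "\<dots> \<subseteq> Field A" by (rule mono_Field) auto
  finally have "S \<subseteq> Field A" .
  with K4 sd show ?thesis unfolding has_isk4_def by fastforce
qed

section \<open>Induced paths and cycles\<close>

definition induced_path :: "('a \<times> 'a) set \<Rightarrow> 'a list \<Rightarrow> bool" where
  "induced_path A xs \<longleftrightarrow> xs \<noteq> [] \<and> distinct xs \<and> Restr A (set xs) = path_arcs xs"

definition induced_cycle :: "('a \<times> 'a) set \<Rightarrow> 'a list \<Rightarrow> bool" where
  "induced_cycle A xs \<longleftrightarrow>
     3 \<le> length xs \<and> distinct xs \<and> Restr A (set xs) = path_arcs (xs @ [hd xs])"

definition connected_set :: "('a \<times> 'a) set \<Rightarrow> 'a set \<Rightarrow> bool" where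
  "connected_set A Z \<longleftrightarrow> (\<forall>x\<in>Z. \<forall>y\<in>Z. (x, y) \<in> (Restr A Z)\<^sup>*)"

locale triangle_free_graph =
  fixes A :: "('a \<times> 'a) set"
  assumes adj_sym: "(x, y) \<in> A \<Longrightarrow> (y, x) \<in> A"
    and no_triangle: "(x, y) \<in> A \<Longrightarrow> (y, z) \<in> A \<Longrightarrow> (x, z) \<notin> A"
begin

lemma adj_commute: "(x, y) \<in> A \<longleftrightarrow> (y, x) \<in> A"
  using adj_sym by blast

lemma adj_irrefl: "(x, x) \<notin> A"
  using no_triangle by blast

lemma Restr_Un:
  assumes "\<And>x y. x \<in> S \<Longrightarrow> y \<in> T \<Longrightarrow> (x, y) \<in> A \<longleftrightarrow> (x, y) \<in> C" "C \<subseteq> S \<times> T"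
  shows "Restr A (S \<union> T) = Restr A S \<union> Restr A T \<union> C \<union> C\<inverse>"
  using assms adj_sym by blast

text \<open>Turns the equation in the definition into a condition on the pairs across a cut, which
  is how paths are cut and glued below. Restricting the equation to the blocks gives one direction,
  \<open>Restr_Un\<close> the other.\<close>

lemma induced_path_append:
  assumes "xs \<noteq> []" "ys \<noteq> []"
  shows "induced_path A (xs @ ys) \<longleftrightarrow> induced_path A xs \<and> induced_path A ys \<and> set xs \<inter> set ys = {}
    \<and> (\<forall>x\<in>set xs. \<forall>y\<in>set ys. (x, y) \<in> A \<longleftrightarrow> x = last xs \<and> y = hd ys)"
  (is "?L \<longleftrightarrow> ?R")
proof -
  have ends: "last xs \<in> set xs" "hd ys \<in> set ys" using assms by auto
  note sub = path_arcs_subset[of xs] path_arcs_subset[of ys]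
  show ?thesis
  proof
    assume L: ?L
    then have d: "set xs \<inter> set ys = {}" "distinct xs" "distinct ys"
      by (auto simp: induced_path_def)
    from L have eq: "Restr A (set xs \<union> set ys)
        = path_arcs xs \<union> path_arcs ys \<union> {(last xs, hd ys), (hd ys, last xs)}"
      by (simp add: induced_path_def path_arcs_append[OF assms])
    have "Restr A (set xs) = Restr A (set xs \<union> set ys) \<inter> set xs \<times> set xs" by auto
    also have "\<dots> = path_arcs xs" unfolding eq using sub d(1) ends by auto
    finally have 1: "induced_path A xs" using assms d by (simp add: induced_path_def)
    have "Restr A (set ys) = Restr A (set xs \<union> set ys) \<inter> set ys \<times> set ys" by auto
    also have "\<dots> = path_arcs ys" unfolding eq using sub d(1) ends by auto
    finally have 2: "induced_path A ys" using assms d by (simp add: induced_path_def)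
    have "(x, y) \<in> A \<longleftrightarrow> x = last xs \<and> y = hd ys" if "x \<in> set xs" "y \<in> set ys" for x y
    proof -
      have "(x, y) \<in> A \<longleftrightarrow> (x, y) \<in> Restr A (set xs \<union> set ys)" using that by auto
      also have "\<dots> \<longleftrightarrow> x = last xs \<and> y = hd ys" unfolding eq using sub d(1) that ends by auto
      finally show ?thesis .
    qed
    with 1 2 d show ?R by blast
  next
    assume R: ?R
    have "Restr A (set xs \<union> set ys)
        = Restr A (set xs) \<union> Restr A (set ys) \<union> {(last xs, hd ys)} \<union> {(last xs, hd ys)}\<inverse>"
      by (rule Restr_Un) (use R ends in auto)
    with R show ?L
      by (auto simp: induced_path_def path_arcs_append[OF assms])
  qed
qed

lemma induced_path_single [simp]: "induced_path A [x]"
  by (auto simp: induced_path_def adj_irrefl)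

lemma induced_path_rev [simp]: "induced_path A (rev xs) \<longleftrightarrow> induced_path A xs"
  by (simp add: induced_path_def)

lemma induced_path_Cons:
  assumes "P \<noteq> []"
  shows "induced_path A (x # P) \<longleftrightarrow>
    induced_path A P \<and> x \<notin> set P \<and> (\<forall>y\<in>set P. (x, y) \<in> A \<longleftrightarrow> y = hd P)"
  using induced_path_append[of "[x]" P] assms by auto

lemma induced_path_suffix: "induced_path A (xs @ ys) \<Longrightarrow> ys \<noteq> [] \<Longrightarrow> induced_path A ys"
  using induced_path_append[of xs ys] by (cases "xs = []") auto

lemma induced_path_prefix: "induced_path A (xs @ ys) \<Longrightarrow> xs \<noteq> [] \<Longrightarrow> induced_path A xs"
  using induced_path_append[of xs ys] by (cases "ys = []") auto

text \<open>The path grows from the end of a walk backwards. If the new vertex \<open>x\<close> is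
  already on the path, the part from \<open>x\<close> on is kept; otherwise \<open>x\<close> is
  joined to its last neighbour on the path and everything before that neighbour is dropped, so no
  chord arises.\<close>

lemma induced_path_exists:
  assumes "(x, y) \<in> (Restr A Z)\<^sup>*" "y \<in> Z"
  shows "\<exists>P. induced_path A P \<and> hd P = x \<and> last P = y \<and> set P \<subseteq> Z"
  using assms(1)
proof (induction rule: converse_rtrancl_induct)
  case base
  show ?case using assms(2) by (intro exI[of _ "[y]"]) auto
next
  case (step x w)
  then obtain P where P: "induced_path A P" "hd P = w" "last P = y" "set P \<subseteq> Z" by blast
  then have P0: "P \<noteq> []" by (auto simp: induced_path_def)
  show ?case
  proof (cases "x \<in> set P")
    case True
    then obtain P1 P2 where "P = P1 @ x # P2" by (meson split_list)
    with P show ?thesis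
      using induced_path_suffix[of P1 "x # P2"] by (intro exI[of _ "x # P2"]) auto
  next
    case False
    have "w \<in> set P" using P0 P(2) by auto
    then have "\<exists>r\<in>set P. (x, r) \<in> A" using step.hyps by auto
    then obtain P1 r P2 where r: "P = P1 @ r # P2" "(x, r) \<in> A" "\<forall>u\<in>set P2. (x, u) \<notin> A"
      by (rule split_list_last_propE) blast
    have "induced_path A (r # P2)" using induced_path_suffix P(1) r(1) by blast
    then have "induced_path A (x # r # P2)"
      using r False by (auto simp: induced_path_Cons)
    then show ?thesis using P r step.hyps by (intro exI[of _ "x # r # P2"]) auto
  qed
qed

section \<open>Connected sets\<close>

lemma path_arcs_rtrancl:
  "u \<in> set xs \<Longrightarrow> v \<in> set xs \<Longrightarrow> (u, v) \<in> (path_arcs xs)\<^sup>*"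
proof (induction xs arbitrary: u v rule: path_arcs.induct)
  case (1 x y zs)
  let ?B = "path_arcs (x # y # zs)"
  have mono: "(path_arcs (y # zs))\<^sup>* \<subseteq> ?B\<^sup>*" by (rule rtrancl_mono) auto
  have from_y: "(y, w) \<in> ?B\<^sup>*" "(w, y) \<in> ?B\<^sup>*" if "w \<in> set (x # y # zs)" for w
    using that 1(1)[of y w] 1(1)[of w y] mono by auto
  show ?case using from_y[OF 1(2)] from_y[OF 1(3)] by (meson rtrancl_trans)
qed auto

lemma connected_set_induced_path: "induced_path A P \<Longrightarrow> connected_set A (set P)"
  by (simp add: connected_set_def induced_path_def path_arcs_rtrancl)

lemma connected_set_Un:
  assumes "connected_set A S" "connected_set A T"
    and "x \<in> S" "y \<in> T" "x = y \<or> (x, y) \<in> A"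
  shows "connected_set A (S \<union> T)"
proof -
  let ?B = "Restr A (S \<union> T)"
  have S: "(u, v) \<in> ?B\<^sup>*" if "u \<in> S" "v \<in> S" for u v
    using assms(1) that rtrancl_mono[of "Restr A S" ?B] unfolding connected_set_def by blast
  have T: "(u, v) \<in> ?B\<^sup>*" if "u \<in> T" "v \<in> T" for u v
    using assms(2) that rtrancl_mono[of "Restr A T" ?B] unfolding connected_set_def by blast
  have xy: "(x, y) \<in> ?B\<^sup>*" "(y, x) \<in> ?B\<^sup>*"
    using assms(3-5) adj_sym by blast+
  have to_x: "(u, x) \<in> ?B\<^sup>*" "(x, u) \<in> ?B\<^sup>*" if "u \<in> S \<union> T" for u
    using that S[OF _ assms(3)] S[OF assms(3)] T[OF _ assms(4)] T[OF assms(4)] xy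
    by (meson UnE rtrancl_trans)+
  then show ?thesis unfolding connected_set_def by (meson rtrancl_trans)
qed

lemma connected_set_insert:
  assumes "connected_set A S" "x \<in> S" "(x, y) \<in> A"
  shows "connected_set A (insert y S)"
  using connected_set_Un[of S "{y}" x y] assms by (simp add: connected_set_def)

section \<open>Cutting and rotating induced cycles\<close>

lemma induced_cycle_append:
  assumes "xs \<noteq> []" "ys \<noteq> []"
  shows "induced_cycle A (xs @ ys) \<longleftrightarrow>
    3 \<le> length xs + length ys \<and> induced_path A xs \<and> induced_path A ys \<and> set xs \<inter> set ys = {}
    \<and> (\<forall>x\<in>set xs. \<forall>y\<in>set ys.
        (x, y) \<in> A \<longleftrightarrow> x = last xs \<and> y = hd ys \<or> x = hd xs \<and> y = last ys)"
  (is "?L \<longleftrightarrow> ?R")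
proof -
  have ends: "last xs \<in> set xs" "hd ys \<in> set ys" "hd xs \<in> set xs" "last ys \<in> set ys"
    using assms by auto
  note sub = path_arcs_subset[of xs] path_arcs_subset[of ys]
  have arcs: "path_arcs ((xs @ ys) @ [hd (xs @ ys)]) = path_arcs xs \<union> path_arcs ys
      \<union> {(last xs, hd ys), (hd ys, last xs), (last ys, hd xs), (hd xs, last ys)}"
    using assms path_arcs_append[of "xs @ ys" "[hd xs]"] path_arcs_append[OF assms] by auto
  show ?thesis
  proof
    assume L: ?L
    then have d: "set xs \<inter> set ys = {}" "distinct xs" "distinct ys"
      by (auto simp: induced_cycle_def)
    from L have eq: "Restr A (set xs \<union> set ys) = path_arcs xs \<union> path_arcs ys
      \<union> {(last xs, hd ys), (hd ys, last xs), (last ys, hd xs), (hd xs, last ys)}"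
      unfolding induced_cycle_def arcs by simp
    have "Restr A (set xs) = Restr A (set xs \<union> set ys) \<inter> set xs \<times> set xs" by auto
    also have "\<dots> = path_arcs xs" unfolding eq using sub d(1) ends by auto
    finally have 1: "induced_path A xs" using assms d by (simp add: induced_path_def)
    have "Restr A (set ys) = Restr A (set xs \<union> set ys) \<inter> set ys \<times> set ys" by auto
    also have "\<dots> = path_arcs ys" unfolding eq using sub d(1) ends by auto
    finally have 2: "induced_path A ys" using assms d by (simp add: induced_path_def)
    have "(x, y) \<in> A \<longleftrightarrow> x = last xs \<and> y = hd ys \<or> x = hd xs \<and> y = last ys"
      if "x \<in> set xs" "y \<in> set ys" for x y
    proof -
      have "(x, y) \<in> A \<longleftrightarrow> (x, y) \<in> Restr A (set xs \<union> set ys)" using that by auto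
      also have "\<dots> \<longleftrightarrow> x = last xs \<and> y = hd ys \<or> x = hd xs \<and> y = last ys"
        unfolding eq using sub d(1) that ends by auto
      finally show ?thesis .
    qed
    moreover have "3 \<le> length xs + length ys" using L by (simp add: induced_cycle_def)
    ultimately show ?R using 1 2 d by blast
  next
    assume R: ?R
    have "Restr A (set xs \<union> set ys) = Restr A (set xs) \<union> Restr A (set ys)
        \<union> {(last xs, hd ys), (hd xs, last ys)} \<union> {(last xs, hd ys), (hd xs, last ys)}\<inverse>"
      by (rule Restr_Un) (use R ends in auto)
    also have "\<dots> = path_arcs xs \<union> path_arcs ys
        \<union> {(last xs, hd ys), (hd ys, last xs), (last ys, hd xs), (hd xs, last ys)}"
      using R by (auto simp: induced_path_def)
    finally show ?L
      unfolding induced_cycle_def arcs using R by (simp add: induced_path_def)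
  qed
qed

lemma induced_cycle_cross:
  assumes "induced_cycle A (xs @ ys)" "xs \<noteq> []" "ys \<noteq> []" "x \<in> set xs" "y \<in> set ys"
  shows "(x, y) \<in> A \<longleftrightarrow> x = last xs \<and> y = hd ys \<or> x = hd xs \<and> y = last ys"
  using assms induced_cycle_append[of xs ys] by blast

lemma induced_cycle_rotate: "induced_cycle A (xs @ ys) \<Longrightarrow> induced_cycle A (ys @ xs)"
proof (cases "xs = [] \<or> ys = []")
  case False
  assume "induced_cycle A (xs @ ys)"
  with False have *: "3 \<le> length xs + length ys" "induced_path A xs" "induced_path A ys"
      "set xs \<inter> set ys = {}"
    and cross: "\<And>x y. x \<in> set xs \<Longrightarrow> y \<in> set ys \<Longrightarrow>
        (x, y) \<in> A \<longleftrightarrow> x = last xs \<and> y = hd ys \<or> x = hd xs \<and> y = last ys"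
    by (auto simp: induced_cycle_append)
  have "(y, x) \<in> A \<longleftrightarrow> y = last ys \<and> x = hd xs \<or> y = hd ys \<and> x = last xs"
    if "y \<in> set ys" "x \<in> set xs" for x y
    using cross[OF that(2,1)] adj_commute[of x y] by blast
  with * False show ?thesis
    by (simp add: induced_cycle_append Int_commute add.commute)
qed auto

section \<open>Cycles with three attached paths\<close>

text \<open>Take an induced path \<open>R\<close> from \<open>p1\<close> to \<open>p2\<close> and
  walk from \<open>p3\<close> to the first vertex \<open>y\<close> on or next to \<open>R\<close>.
  If \<open>y\<close> is off \<open>R\<close> with a single neighbour there, that neighbour is the
  centre. If it has several, \<open>y\<close> is the centre and two legs start at its first and last
  neighbour on \<open>R\<close>, which are not adjacent as there are no triangles. Legs may be empty
  and the three targets may coincide.\<close>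

lemma tripod_exists:
  assumes Z: "connected_set A Z" and p: "p1 \<in> Z" "p2 \<in> Z" "p3 \<in> Z"
  obtains z L1 L2 L3 where "set (z # L1 @ L2 @ L3) \<subseteq> Z" "distinct (z # L1 @ L2 @ L3)"
    "Restr A (set (z # L1 @ L2 @ L3)) = path_arcs (z # L1) \<union> path_arcs (z # L2) \<union> path_arcs (z # L3)"
    "last (z # L1) = p1" "last (z # L2) = p2" "last (z # L3) = p3"
proof -
  note goal = that
  \<comment> \<open>The part common to all cases: the first two legs form one induced path through
    \<open>z\<close>, and the third leg touches it only via \<open>z\<close>.\<close>
  have tripod: thesis
    if R: "induced_path A (rev L1 @ z # L2)" and L3: "induced_path A (z # L3)"
      and dj: "set L3 \<inter> set (L1 @ L2) = {}"
      and cross: "\<forall>x\<in>set L3. \<forall>y\<in>set (L1 @ L2). (x, y) \<notin> A"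
      and rest: "set (z # L1 @ L2 @ L3) \<subseteq> Z"
        "last (z # L1) = p1" "last (z # L2) = p2" "last (z # L3) = p3"
    for z L1 L2 L3
  proof (rule goal[of z L1 L2 L3])
    show "distinct (z # L1 @ L2 @ L3)" using R L3 dj by (auto simp: induced_path_def)
    have "path_arcs (rev L1 @ [z]) = path_arcs (z # L1)"
      using path_arcs_rev[of "z # L1"] by simp
    then have "path_arcs (rev L1 @ z # L2) = path_arcs (z # L1) \<union> path_arcs (z # L2)"
      using path_arcs_append_Cons[of "rev L1" z L2] by simp
    moreover have "Restr A (set (z # L1 @ L2 @ L3))
        = Restr A (set (rev L1 @ z # L2)) \<union> Restr A (set (z # L3))"
      using cross adj_sym by auto
    ultimately show "Restr A (set (z # L1 @ L2 @ L3))
        = path_arcs (z # L1) \<union> path_arcs (z # L2) \<union> path_arcs (z # L3)"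
      using R L3 by (simp add: induced_path_def)
  qed fact+
  obtain R where R: "induced_path A R" "hd R = p1" "last R = p2" "set R \<subseteq> Z"
    using induced_path_exists Z p unfolding connected_set_def by metis
  obtain M where M: "induced_path A M" "hd M = p3" "last M = p1" "set M \<subseteq> Z"
    using induced_path_exists Z p unfolding connected_set_def by metis
  have R0: "R \<noteq> []" and M0: "M \<noteq> []" using R M by (auto simp: induced_path_def)
  show thesis
  proof (cases "p3 \<in> set R")
    case True
    then obtain R1 R2 where eq: "R = R1 @ p3 # R2" by (meson split_list)
    show thesis
      by (rule tripod[of "rev R1" p3 R2 "[]"]) (use R eq in \<open>auto simp: last_rev hd_append split: if_splits\<close>)
  next
    case False
    let ?P = "\<lambda>y. y \<in> set R \<or> (\<exists>r\<in>set R. (y, r) \<in> A)"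
    have "\<exists>y\<in>set M. ?P y" using M(3) M0 R(2) R0 last_in_set[OF M0] hd_in_set[OF R0] by metis
    then obtain M1 y M2 where y: "M = M1 @ y # M2" "?P y" "\<forall>u\<in>set M1. \<not> ?P u"
      by (rule split_list_first_propE) blast
    have yM1: "induced_path A (M1 @ [y])"
      using induced_path_prefix[of "M1 @ [y]" M2] M(1) y(1) by simp
    then have yM1': "induced_path A (y # rev M1)"
      using induced_path_rev[of "M1 @ [y]"] by simp
    have last3: "last (y # rev M1) = p3" using M(2) y(1) by (cases M1) auto
    have "y \<notin> set R"
    proof
      assume "y \<in> set R"
      show False
      proof (cases "M1 = []")
        case True
        then show ?thesis using \<open>y \<in> set R\<close> last3 False by simp
      next
        case False
        then have "(last M1, y) \<in> A" using yM1 induced_path_append[of M1 "[y]"] by simp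
        with y(3) \<open>y \<in> set R\<close> False show ?thesis by (meson last_in_set)
      qed
    qed
    with y(2) have "\<exists>r\<in>set R. (y, r) \<in> A" by blast
    then obtain R1 r R2 where r: "R = R1 @ r # R2" "(y, r) \<in> A" "\<forall>u\<in>set R1. (y, u) \<notin> A"
      by (rule split_list_first_propE) blast
    show thesis
    proof (cases "\<exists>u\<in>set R2. (y, u) \<in> A")
      case False
      show thesis
      proof (rule tripod[of "rev R1" r R2 "y # rev M1"])
        show "induced_path A (r # y # rev M1)"
          using yM1' y(3) r \<open>y \<notin> set R\<close> adj_commute by (auto simp: induced_path_Cons)
        show "\<forall>x\<in>set (y # rev M1). \<forall>u\<in>set (rev R1 @ R2). (x, u) \<notin> A"
          using y(3) r False by auto
        show "set (y # rev M1) \<inter> set (rev R1 @ R2) = {}"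
          using y(3) r \<open>y \<notin> set R\<close> by auto
        show "last (r # rev R1) = p1" using R(2) r(1) by (cases R1) auto
        show "last (r # R2) = p2" using R(3) r(1) by simp
        show "last (r # y # rev M1) = p3" using last3 by simp
      qed (use R M r y in auto)
    next
      case True
      then obtain R3 r' R4 where r': "R2 = R3 @ r' # R4" "(y, r') \<in> A" "\<forall>u\<in>set R4. (y, u) \<notin> A"
        by (rule split_list_last_propE) blast
      have Req: "R = (R1 @ [r]) @ (R3 @ r' # R4)" using r r' by simp
      have p1: "induced_path A (R1 @ [r])" and p2: "induced_path A (r' # R4)"
        using R(1) unfolding Req by (blast intro: induced_path_prefix induced_path_suffix)+
      have nadj: "(r, r') \<notin> A" using r(2) r'(2) no_triangle adj_sym by blast
      have cross: "(u, w) \<in> A \<longleftrightarrow> u = r \<and> w = hd (R3 @ r' # R4)"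
        if "u \<in> set (R1 @ [r])" "w \<in> set (R3 @ r' # R4)" for u w
        using R(1) that induced_path_append[of "R1 @ [r]" "R3 @ r' # R4"] unfolding Req by auto
      \<comment> \<open>The successor of \<open>r\<close> on \<open>R\<close> is thus a vertex
        strictly between \<open>r\<close> and \<open>r'\<close>. It is bypassed through
        \<open>y\<close>, and with it goes the only arc of \<open>R\<close> between the two
        remaining pieces.\<close>
      have "hd (R3 @ r' # R4) \<noteq> r'" using cross[of r r'] nadj by auto
      then have R3: "R3 \<noteq> []" by auto
      then have hd: "hd (R3 @ r' # R4) \<notin> set (r' # R4)"
        using R(1) unfolding Req induced_path_def by (cases R3) auto
      have dj: "set (R1 @ [r]) \<inter> set (y # r' # R4) = {}"
        using R(1) \<open>y \<notin> set R\<close> unfolding Req induced_path_def by auto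
      have cross': "(u, w) \<in> A \<longleftrightarrow> u = r \<and> w = y"
        if "u \<in> set (R1 @ [r])" "w \<in> set (y # r' # R4)" for u w
      proof (cases "w = y")
        case True
        then show ?thesis using that(1) r(2,3) adj_commute[of u y] by auto
      next
        case False
        then have "w \<noteq> hd (R3 @ r' # R4)" "w \<in> set (R3 @ r' # R4)" using that(2) hd by auto
        then show ?thesis using cross[OF that(1), of w] False by blast
      qed
      show thesis
      proof (rule tripod[of "r # rev R1" y "r' # R4" "rev M1"])
        have "induced_path A (y # r' # R4)"
          using p2 r' \<open>y \<notin> set R\<close> Req by (auto simp: induced_path_Cons)
        then have "induced_path A ((R1 @ [r]) @ (y # r' # R4))"
          using p1 dj cross' by (subst induced_path_append) simp_all
        then show "induced_path A (rev (r # rev R1) @ y # r' # R4)" by simp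
        show "\<forall>x\<in>set (rev M1). \<forall>u\<in>set ((r # rev R1) @ r' # R4). (x, u) \<notin> A"
          "set (rev M1) \<inter> set ((r # rev R1) @ r' # R4) = {}"
          using y(3) Req by auto
        show "last (y # r # rev R1) = p1" using R(2) r(1) by (cases R1) auto
        show "last (y # r' # R4) = p2" using R(3) Req by simp
        show "set (y # (r # rev R1) @ (r' # R4) @ rev M1) \<subseteq> Z" using R M r r' y by auto
      qed (use yM1' last3 in auto)
    qed
  qed
qed

text \<open>The branch vertices are \<open>d1\<close>, \<open>d2\<close>, \<open>d3\<close> and the
  centre of a tripod in \<open>Z\<close>; the six paths are the three arcs of the cycle and the
  three legs, prolonged to the cycle. The vertices \<open>p1\<close>, \<open>p2\<close>,
  \<open>p3\<close> may coincide.\<close>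

lemma isk4_of_attachments:
  assumes D: "D = d1 # I1 @ d2 # I2 @ d3 # I3" and cyc: "induced_cycle A D"
    and Z: "connected_set A Z" "Z \<inter> set D = {}" "p1 \<in> Z" "p2 \<in> Z" "p3 \<in> Z"
    and cross: "\<And>x y. x \<in> set D \<Longrightarrow> y \<in> Z \<Longrightarrow>
      (x, y) \<in> A \<longleftrightarrow> x = d1 \<and> y = p1 \<or> x = d2 \<and> y = p2 \<or> x = d3 \<and> y = p3"
  shows "has_isk4 A"
proof -
  let ?D = "d1 # I1 @ d2 # I2 @ d3 # I3"
  note cyc = cyc[unfolded D]
  note Z = Z[unfolded D]
  note cross = cross[unfolded D]
  obtain z L1 L2 L3 where T: "set (z # L1 @ L2 @ L3) \<subseteq> Z" "distinct (z # L1 @ L2 @ L3)"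
    "Restr A (set (z # L1 @ L2 @ L3)) = path_arcs (z # L1) \<union> path_arcs (z # L2) \<union> path_arcs (z # L3)"
    "last (z # L1) = p1" "last (z # L2) = p2" "last (z # L3) = p3"
    using tripod_exists[OF Z(1,3-5)] by metis
  let ?T = "z # L1 @ L2 @ L3"
  have p: "p1 \<in> set ?T" "p2 \<in> set ?T" "p3 \<in> set ?T"
    using T(4-6) by (auto split: if_splits)
  have D: "path_arcs (?D @ [hd ?D])
      = path_arcs (d1 # I1 @ [d2]) \<union> path_arcs (d2 # I2 @ [d3]) \<union> path_arcs (d3 # I3 @ [d1])"
    using path_arcs_append_Cons[of "d1 # I1" d2 "I2 @ d3 # I3 @ [d1]"]
      path_arcs_append_Cons[of "d2 # I2" d3 "I3 @ [d1]"] by auto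
  have leg: "path_arcs (d # rev L @ [z]) = path_arcs (z # L) \<union> {(d, last (z # L)), (last (z # L), d)}" for d L
    using path_arcs_append[of "z # L" "[d]"] path_arcs_rev[of "z # L @ [d]"] by auto
  have "Restr A (set ?D \<union> set ?T) = Restr A (set ?D) \<union> Restr A (set ?T)
      \<union> {(d1, p1), (d2, p2), (d3, p3)} \<union> {(d1, p1), (d2, p2), (d3, p3)}\<inverse>"
  proof (rule Restr_Un)
    fix x y assume "x \<in> set ?D" "y \<in> set ?T"
    moreover from this have "y \<in> Z" using T(1) by blast
    ultimately show "(x, y) \<in> A \<longleftrightarrow> (x, y) \<in> {(d1, p1), (d2, p2), (d3, p3)}"
      using cross[of x y] by simp
  qed (use p in auto)
  also have "Restr A (set ?D) = path_arcs (d1 # I1 @ [d2]) \<union> path_arcs (d2 # I2 @ [d3]) \<union> path_arcs (d3 # I3 @ [d1])"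
    using cyc unfolding induced_cycle_def D by blast
  also have "path_arcs (d3 # I3 @ [d1]) = path_arcs (d1 # rev I3 @ [d3])"
    using path_arcs_rev[of "d3 # I3 @ [d1]"] by simp
  finally have arcs: "Restr A (set ?D \<union> set ?T) = path_arcs (d1 # I1 @ [d2]) \<union> path_arcs (d1 # rev I3 @ [d3])
      \<union> path_arcs (d1 # rev L1 @ [z]) \<union> path_arcs (d2 # I2 @ [d3]) \<union> path_arcs (d2 # rev L2 @ [z])
      \<union> path_arcs (d3 # rev L3 @ [z])"
    unfolding T(3) leg T(4-6) by auto
  show ?thesis
  proof (rule has_isk4I)
    show "distinct ([d1, d2, d3, z] @ I1 @ rev I3 @ rev L1 @ I2 @ rev L2 @ rev L3)"
      using cyc T(1,2) Z(2) unfolding induced_cycle_def by auto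
    show "set ?D \<union> set ?T = set ([d1, d2, d3, z] @ I1 @ rev I3 @ rev L1 @ I2 @ rev L2 @ rev L3)"
      by auto
  qed (fact arcs)
qed

text \<open>With two neighbours of \<open>v\<close> on \<open>Q\<close>, the cycle \<open>D\<close>
  has four edges to \<open>Q\<close>, so the cycle is exchanged: the arc from \<open>s1\<close> to
  \<open>s2\<close> is closed up by \<open>Q\<close>, and the path formed by \<open>A2\<close> and
  \<open>v\<close> is attached at \<open>s2\<close> and at the two neighbours of \<open>v\<close>.
  The arc \<open>A1\<close> is discarded; being nonempty, it keeps \<open>v\<close> from being
  adjacent to \<open>s1\<close>.\<close>

lemma isk4_of_two_neighbours:
  assumes D: "D = v # A1 @ s1 # A12 @ s2 # A2" and cyc: "induced_cycle A D"
    and "A1 \<noteq> []"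
    and Q: "induced_path A Q" "set Q \<inter> set D = {}"
    and cross: "\<And>x y. x \<in> set D - {v} \<Longrightarrow> y \<in> set Q \<Longrightarrow>
      (x, y) \<in> A \<longleftrightarrow> x = s1 \<and> y = hd Q \<or> x = s2 \<and> y = last Q"
    and z: "z1 \<in> set Q" "z2 \<in> set Q" "z1 \<noteq> z2"
    and v: "\<And>y. y \<in> set Q \<Longrightarrow> (v, y) \<in> A \<longleftrightarrow> y = z1 \<or> y = z2"
  shows "has_isk4 A"
proof -
  let ?D = "v # A1 @ s1 # A12 @ s2 # A2"
  note cyc = cyc[unfolded D]
  note Q = Q[unfolded D]
  note cross = cross[unfolded D]
  have "\<exists>Q1 y1 Q2 y2 Q3. Q = Q1 @ y1 # Q2 @ y2 # Q3 \<and> {y1, y2} = {z1, z2}"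
  proof -
    obtain Q1 Q' where Q': "Q = Q1 @ z1 # Q'" using z(1) by (meson split_list)
    then consider "z2 \<in> set Q1" | "z2 \<in> set Q'" using z by auto
    then show ?thesis
    proof cases
      case 1
      then obtain Q3 Q4 where "Q1 = Q3 @ z2 # Q4" by (meson split_list)
      with Q' have "Q = Q3 @ z2 # Q4 @ z1 # Q'" by simp
      then show ?thesis by (metis insert_commute)
    next
      case 2
      then obtain Q3 Q4 where "Q' = Q3 @ z2 # Q4" by (meson split_list)
      with Q' show ?thesis by blast
    qed
  qed
  then obtain Q1 y1 Q2 y2 Q3 where Qeq: "Q = Q1 @ y1 # Q2 @ y2 # Q3" and y: "{y1, y2} = {z1, z2}"
    by blast
  let ?S = "s1 # A12 @ [s2]"
  have rot: "induced_cycle A (?S @ (A2 @ v # A1))"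
    using induced_cycle_rotate[of "v # A1" "?S @ A2"] cyc by simp
  then have S: "induced_path A ?S" and VA: "induced_path A (A2 @ v # A1)"
    and SVA: "set ?S \<inter> set (A2 @ v # A1) = {}"
    and crossS: "\<And>x y. x \<in> set ?S \<Longrightarrow> y \<in> set (A2 @ v # A1) \<Longrightarrow>
      (x, y) \<in> A \<longleftrightarrow> x = s2 \<and> y = hd (A2 @ v # A1) \<or> x = s1 \<and> y = last (v # A1)"
    using induced_cycle_cross[OF rot] induced_cycle_append[of ?S "A2 @ v # A1"] by simp_all
  have dVA: "distinct (A2 @ v # A1)" using VA by (simp add: induced_path_def)
  have Q0: "Q \<noteq> []" using Q by (simp add: induced_path_def)
  have "induced_cycle A (rev ?S @ Q)"
  proof (subst induced_cycle_append)
    show "3 \<le> length (rev ?S) + length Q \<and> induced_path A (rev ?S) \<and> induced_path A Q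
      \<and> set (rev ?S) \<inter> set Q = {} \<and> (\<forall>x\<in>set (rev ?S). \<forall>y\<in>set Q. ((x, y) \<in> A)
        = (x = last (rev ?S) \<and> y = hd Q \<or> x = hd (rev ?S) \<and> y = last Q))"
    proof (intro conjI ballI)
      show "3 \<le> length (rev ?S) + length Q" using Q0 by (cases Q) auto
      show "induced_path A (rev ?S)" using S induced_path_rev by blast
      show "set (rev ?S) \<inter> set Q = {}" using Q(2) by auto
      fix x y assume "x \<in> set (rev ?S)" "y \<in> set Q"
      moreover from this have "x \<in> set ?D - {v}" using SVA by auto
      ultimately show "((x, y) \<in> A) = (x = last (rev ?S) \<and> y = hd Q \<or> x = hd (rev ?S) \<and> y = last Q)"
        using cross[of x y] by simp
    qed (fact Q)
  qed (use Q0 in auto)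
  then have cyc': "induced_cycle A (s2 # (rev A12 @ s1 # Q1) @ y1 # Q2 @ y2 # Q3)"
    by (simp add: Qeq)
  have lastA1: "last (v # A1) \<in> set A1" using \<open>A1 \<noteq> []\<close> by simp
  show ?thesis
  \<comment> \<open>Two of the three attachments use the same vertex \<open>v\<close>; if
    \<open>A2\<close> is empty, so does the third.\<close>
  proof (rule isk4_of_attachments[OF refl cyc', of "set (A2 @ [v])" "hd (A2 @ [v])" v v])
    have "induced_path A (A2 @ [v])" using induced_path_prefix[of "A2 @ [v]" A1] VA by simp
    then show "connected_set A (set (A2 @ [v]))" by (rule connected_set_induced_path)
    show "set (A2 @ [v]) \<inter> set (s2 # (rev A12 @ s1 # Q1) @ y1 # Q2 @ y2 # Q3) = {}"
      using Q(2) SVA Qeq by auto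
    show "hd (A2 @ [v]) \<in> set (A2 @ [v])" by (cases A2) auto
    fix x u assume x: "x \<in> set (s2 # (rev A12 @ s1 # Q1) @ y1 # Q2 @ y2 # Q3)"
      and u: "u \<in> set (A2 @ [v])"
    have hd_eq: "hd (A2 @ v # A1) = hd (A2 @ [v])" by (cases A2) auto
    from x consider "x \<in> set ?S" | "x \<in> set Q" by (auto simp: Qeq)
    then show "(x, u) \<in> A \<longleftrightarrow> x = s2 \<and> u = hd (A2 @ [v]) \<or> x = y1 \<and> u = v \<or> x = y2 \<and> u = v"
    proof cases
      case 1
      then have "x \<noteq> y1" "x \<noteq> y2" using Q(2) Qeq by auto
      moreover have "u \<noteq> last (v # A1)" using lastA1 u dVA by auto
      ultimately show ?thesis using crossS[of x u] 1 u hd_eq by auto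
    next
      case 2
      then have "x \<noteq> s2" using Q(2) by auto
      show ?thesis
      proof (cases "u = v")
        case True
        then show ?thesis using v[OF 2] y \<open>x \<noteq> s2\<close> adj_commute[of x u] by auto
      next
        case False
        then have "u \<in> set ?D - {v}" "u \<noteq> s1" "u \<noteq> s2" using u SVA by auto
        then show ?thesis using cross[of u x] 2 False \<open>x \<noteq> s2\<close> adj_commute[of x u] by auto
      qed
    qed
  qed auto
qed

end

section \<open>Long induced cycles in a layer\<close>

lemma split_list_two:
  assumes "x \<in> set xs" "y \<in> set xs" "x \<noteq> y"
  obtains u v B1 B2 B3 where "xs = B1 @ u # B2 @ v # B3" "{u, v} = {x, y}"
proof -
  obtain B C where B: "xs = B @ x # C" using assms(1) by (meson split_list)
  then consider "y \<in> set B" | "y \<in> set C" using assms by auto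
  then show thesis
  proof cases
    case 1
    then obtain D E where "B = D @ y # E" by (meson split_list)
    with B show thesis using that[of D y E x C] by auto
  next
    case 2
    then obtain D E where "C = D @ y # E" by (meson split_list)
    with B show thesis using that[of B x D y E] by auto
  qed
qed

text \<open>
  Here \<open>X\<close> is a layer $N_k$, \<open>W\<close> is $N_{k-1}$ and \<open>H\<close> is the union of the earlier layers; \<open>U\<close> is
  a path of steps down to the root, so it meets the layer next to \<open>W\<close> only in \<open>u\<close>.
\<close>

locale layered_graph = triangle_free_graph A for A :: "('a \<times> 'a) set" +
  fixes X W H :: "'a set" and r :: 'a
  assumes disjoint: "X \<inter> W = {}" "X \<inter> H = {}" "W \<inter> H = {}"
    and X_H: "x \<in> X \<Longrightarrow> h \<in> H \<Longrightarrow> (x, h) \<notin> A"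
    and parent: "x \<in> X \<Longrightarrow> \<exists>w\<in>W. (x, w) \<in> A"
    and upset: "w \<in> W \<Longrightarrow> \<exists>U u. U \<subseteq> H \<and> connected_set A U \<and> r \<in> U \<and> u \<in> U \<and> (w, u) \<in> A
      \<and> (\<forall>v\<in>W. \<forall>y\<in>U. (v, y) \<in> A \<longrightarrow> y = u)"
    and isk4_free: "\<not> has_isk4 A"
begin

text \<open>
  Going through the descending paths from \<open>w1\<close> and \<open>w2\<close> keeps the number of neighbours of \<open>v\<close> on
  the connection at most two, one for each of \<open>w1\<close> and \<open>w2\<close>.
\<close>

lemma link:
  assumes "v \<in> W" "w1 \<in> W" "w2 \<in> W" "v \<noteq> w1" "v \<noteq> w2"
  shows "(\<exists>Z p. connected_set A Z \<and> w1 \<in> Z \<and> w2 \<in> Z \<and> Z \<subseteq> {w1, w2} \<union> H \<and> p \<in> Z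
      \<and> (\<forall>y\<in>Z. (v, y) \<in> A \<longleftrightarrow> y = p))
    \<or> (\<exists>Q z1 z2. induced_path A Q \<and> hd Q = w1 \<and> last Q = w2 \<and> set Q \<subseteq> {w1, w2} \<union> H
      \<and> z1 \<in> set Q \<and> z2 \<in> set Q \<and> z1 \<noteq> z2 \<and> (\<forall>y\<in>set Q. (v, y) \<in> A \<longleftrightarrow> y = z1 \<or> y = z2))"
  (is "(\<exists>Z p. ?Z Z p) \<or> ?Q")
proof -
  obtain U1 u1 where U1: "U1 \<subseteq> H" "connected_set A U1" "r \<in> U1" "u1 \<in> U1" "(w1, u1) \<in> A"
    "\<And>x y. x \<in> W \<Longrightarrow> y \<in> U1 \<Longrightarrow> (x, y) \<in> A \<Longrightarrow> y = u1"
    using upset[OF assms(2)] by auto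
  obtain U2 u2 where U2: "U2 \<subseteq> H" "connected_set A U2" "r \<in> U2" "u2 \<in> U2" "(w2, u2) \<in> A"
    "\<And>x y. x \<in> W \<Longrightarrow> y \<in> U2 \<Longrightarrow> (x, y) \<in> A \<Longrightarrow> y = u2"
    using upset[OF assms(3)] by auto
  obtain U3 u3 where U3: "U3 \<subseteq> H" "connected_set A U3" "r \<in> U3" "u3 \<in> U3" "(v, u3) \<in> A"
    "\<And>x y. x \<in> W \<Longrightarrow> y \<in> U3 \<Longrightarrow> (x, y) \<in> A \<Longrightarrow> y = u3"
    using upset[OF assms(1)] by auto
  define S where "S = insert w1 U1 \<union> insert w2 U2"
  have "connected_set A (insert w1 U1)" "connected_set A (insert w2 U2)"
    using connected_set_insert[OF U1(2,4)] connected_set_insert[OF U2(2,4)] U1(5) U2(5) adj_sym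
    by blast+
  then have S: "connected_set A S"
    unfolding S_def by (rule connected_set_Un[of _ _ r r]) (use U1 U2 in auto)
  have S_sub: "S \<subseteq> {w1, w2} \<union> H" using U1 U2 by (auto simp: S_def)
  have nbrs: "y \<in> {w1, u1, w2, u2}" if "y \<in> S" "(v, y) \<in> A" for y
    using that U1(6)[OF assms(1)] U2(6)[OF assms(1)] by (auto simp: S_def)
  \<comment> \<open>In \<open>S\<close> only these four vertices can be neighbours of
    \<open>v\<close>. Since \<open>w1 u1\<close> and \<open>w2 u2\<close> are edges, each of the two
    pairs contains at most one neighbour.\<close>
  have excl: "\<not> ((v, w1) \<in> A \<and> (v, u1) \<in> A)" "\<not> ((v, w2) \<in> A \<and> (v, u2) \<in> A)"
    using no_triangle[of v w1 u1] no_triangle[of v w2 u2] U1(5) U2(5) by auto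
  have "w1 \<in> S" "w2 \<in> S" by (auto simp: S_def)
  then obtain Q where Q: "induced_path A Q" "hd Q = w1" "last Q = w2" "set Q \<subseteq> S"
    using S induced_path_exists unfolding connected_set_def by metis
  have Q0: "Q \<noteq> []" using Q(1) by (simp add: induced_path_def)
  have wQ: "w1 \<in> set Q" "w2 \<in> set Q" using Q(2,3) Q0 by auto
  have Qc: "connected_set A (set Q)" using Q(1) by (rule connected_set_induced_path)
  consider (two) z1 z2 where "z1 \<in> set Q" "z2 \<in> set Q" "z1 \<noteq> z2" "(v, z1) \<in> A" "(v, z2) \<in> A"
    | (one) p where "p \<in> set Q" "\<And>y. y \<in> set Q \<Longrightarrow> (v, y) \<in> A \<longleftrightarrow> y = p"
    | (none) "\<And>y. y \<in> set Q \<Longrightarrow> (v, y) \<notin> A"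
    by blast
  then show ?thesis
  proof cases
    case two
    have "y = z1 \<or> y = z2" if "y \<in> set Q" "(v, y) \<in> A" for y
      using nbrs[of y] nbrs[of z1] nbrs[of z2] Q(4) that two excl by blast
    then have "\<forall>y\<in>set Q. (v, y) \<in> A \<longleftrightarrow> y = z1 \<or> y = z2" using two by blast
    moreover have "set Q \<subseteq> {w1, w2} \<union> H" using Q(4) S_sub by blast
    ultimately show ?thesis using two(1-3) Q(1-3) by blast
  next
    case one
    have "?Z (set Q) p" using Qc wQ Q(4) S_sub one by blast
    then show ?thesis by blast
  next
    \<comment> \<open>A neighbour of \<open>v\<close> has to be added, but exactly one:
      \<open>u1\<close> or \<open>u2\<close> alone if \<open>v\<close> sees it, and otherwise the
      descent from \<open>v\<close> itself, which meets \<open>S\<close> in the root and in which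
      \<open>v\<close> sees only \<open>u3\<close>.\<close>
    case none
    show ?thesis
    proof (cases "(v, u1) \<in> A \<or> (v, u2) \<in> A")
      case True
      then obtain u where u: "(v, u) \<in> A" "u = u1 \<or> u = u2" by blast
      then have "connected_set A (insert u (set Q))"
        using connected_set_insert[OF Qc] wQ U1(5) U2(5) by blast
      moreover have "u \<in> H" using u U1 U2 by auto
      ultimately have "?Z (insert u (set Q)) u" using wQ Q(4) S_sub none u(1) by blast
      then show ?thesis by blast
    next
      case False
      have "connected_set A (S \<union> U3)"
        by (rule connected_set_Un[OF S U3(2), of r r]) (use U1 U3 in \<open>auto simp: S_def\<close>)
      moreover have "(v, y) \<in> A \<longleftrightarrow> y = u3" if "y \<in> S \<union> U3" for y
        using that nbrs[of y] none wQ False U3(5) U3(6)[OF assms(1), of y] by blast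
      ultimately have "?Z (S \<union> U3) u3" using \<open>w1 \<in> S\<close> \<open>w2 \<in> S\<close> S_sub U3 by blast
      then show ?thesis by blast
    qed
  qed
qed

text \<open>\<open>link\<close> joins \<open>w1\<close> and \<open>w2\<close> off the cycle. If
  \<open>v\<close> has one neighbour on the connection, the attachments are at \<open>v\<close>,
  \<open>s1\<close>, \<open>s2\<close>; if it has two, \<open>isk4_of_two_neighbours\<close>
  applies. An edge from \<open>v\<close> to \<open>w1\<close> or \<open>w2\<close> does no harm, as
  it is among the neighbours counted by \<open>link\<close>.\<close>

lemma no_two_private_neighbours:
  assumes cyc: "induced_cycle A (v # A1 @ s1 # A12 @ s2 # A2)"
    and "A1 \<noteq> []" "v \<in> W" "set (A1 @ s1 # A12 @ s2 # A2) \<subseteq> X"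
    and w: "w1 \<in> W" "w2 \<in> W" "w1 \<noteq> v" "w2 \<noteq> v"
    and w1: "\<And>x. x \<in> set (A1 @ s1 # A12 @ s2 # A2) \<Longrightarrow> (x, w1) \<in> A \<longleftrightarrow> x = s1"
    and w2: "\<And>x. x \<in> set (A1 @ s1 # A12 @ s2 # A2) \<Longrightarrow> (x, w2) \<in> A \<longleftrightarrow> x = s2"
  shows False
proof -
  define D' where "D' = A1 @ s1 # A12 @ s2 # A2"
  have D'X: "set D' \<subseteq> X" and s: "s1 \<in> set D'" "s2 \<in> set D'"
    using assms(4) by (auto simp: D'_def)
  have "v \<notin> set D'" "s1 \<noteq> s2" using cyc by (auto simp: induced_cycle_def D'_def)
  note w1 = w1[folded D'_def] and w2 = w2[folded D'_def]
  have "w1 \<noteq> w2" using w1[OF s(1)] w2[OF s(1)] \<open>s1 \<noteq> s2\<close> by auto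
  have cross: "(x, y) \<in> A \<longleftrightarrow> x = s1 \<and> y = w1 \<or> x = s2 \<and> y = w2"
    if "x \<in> set D'" "y \<in> {w1, w2} \<union> H" for x y
    using that w1[of x] w2[of x] X_H[of x y] D'X w \<open>w1 \<noteq> w2\<close> disjoint(3) by auto
  have dj: "({w1, w2} \<union> H) \<inter> set (v # D') = {}"
    using D'X disjoint w \<open>v \<in> W\<close> by auto
  from link[OF \<open>v \<in> W\<close> w(1,2)] w(3,4) consider
    (Z) Z p where "connected_set A Z" "w1 \<in> Z" "w2 \<in> Z" "Z \<subseteq> {w1, w2} \<union> H" "p \<in> Z"
      "\<forall>y\<in>Z. (v, y) \<in> A \<longleftrightarrow> y = p"
  | (Q) Q z1 z2 where "induced_path A Q" "hd Q = w1" "last Q = w2" "set Q \<subseteq> {w1, w2} \<union> H"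
      "z1 \<in> set Q" "z2 \<in> set Q" "z1 \<noteq> z2" "\<forall>y\<in>set Q. (v, y) \<in> A \<longleftrightarrow> y = z1 \<or> y = z2"
    by blast
  then have "has_isk4 A"
  proof cases
    case Z
    show ?thesis
    proof (rule isk4_of_attachments[of _ v A1 s1 A12 s2 A2 Z p w1 w2, OF refl cyc])
      fix x y assume "x \<in> set (v # A1 @ s1 # A12 @ s2 # A2)" "y \<in> Z"
      then have "x = v \<or> x \<in> set D'" "y \<in> {w1, w2} \<union> H" using Z(4) by (auto simp: D'_def)
      then show "(x, y) \<in> A \<longleftrightarrow> x = v \<and> y = p \<or> x = s1 \<and> y = w1 \<or> x = s2 \<and> y = w2"
        using cross[of x y] Z(6) \<open>y \<in> Z\<close> \<open>v \<notin> set D'\<close> s by blast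
    next
      show "Z \<inter> set (v # A1 @ s1 # A12 @ s2 # A2) = {}"
        using dj Z(4) by (auto simp: D'_def)
    qed (use Z in auto)
  next
    case Q
    show ?thesis
    proof (rule isk4_of_two_neighbours[OF refl cyc \<open>A1 \<noteq> []\<close> Q(1) _ _ Q(5-7)])
      show "set Q \<inter> set (v # A1 @ s1 # A12 @ s2 # A2) = {}"
        using dj Q(4) by (auto simp: D'_def)
      fix x y assume "x \<in> set (v # A1 @ s1 # A12 @ s2 # A2) - {v}" "y \<in> set Q"
      then have "x \<in> set D'" "y \<in> {w1, w2} \<union> H" using Q(4) by (auto simp: D'_def)
      then show "(x, y) \<in> A \<longleftrightarrow> x = s1 \<and> y = hd Q \<or> x = s2 \<and> y = last Q"
        using cross[of x y] Q(2,3) by simp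
    qed (use Q(8) in blast)
  qed
  with isk4_free show False ..
qed

text \<open>The square \<open>v\<close>, \<open>a1\<close>, \<open>s\<close>, \<open>a2\<close>
  serves as the cycle, with \<open>w\<close> attached at \<open>s\<close> and \<open>y\<close> at
  \<open>a2\<close>, where \<open>y\<close> is reached from \<open>w\<close> through
  \<open>q\<close>. The case \<open>q = w\<close> shows that parents of \<open>s\<close> miss
  \<open>y\<close>; given this, the other case forces parents of \<open>y\<close> to be adjacent to
  \<open>a1\<close>.\<close>

lemma no_parent_beyond_square:
  assumes P: "induced_path A [a1, s, a2, y]" "{a1, s, a2, y} \<subseteq> X"
    and v: "v \<in> W" "(v, a1) \<in> A" "(v, a2) \<in> A"
    and w: "w \<in> W" "(w, s) \<in> A" and q: "q \<in> W" "(q, y) \<in> A" "(q, a1) \<notin> A"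
    and qw: "q = w \<or> (w, y) \<notin> A \<and> (q, s) \<notin> A"
  shows False
proof -
  have adj: "(a1, s) \<in> A" "(s, a2) \<in> A" "(a2, y) \<in> A" "(a1, a2) \<notin> A" "(a1, y) \<notin> A" "(s, y) \<notin> A"
    and dist: "distinct [a1, s, a2, y]"
    using P(1) by (auto simp: induced_path_Cons)
  have nadj: "(v, s) \<notin> A" "(v, y) \<notin> A" "(w, a1) \<notin> A" "(w, a2) \<notin> A" "(q, a2) \<notin> A"
    using no_triangle adj v(2,3) w(2) q(2) adj_sym by blast+
  have "v \<noteq> w" "v \<noteq> q" using nadj w q by auto
  have cyc: "induced_cycle A (v # [a1] @ s # [] @ a2 # [])"
  proof -
    have "induced_path A [a1, s, a2]" using induced_path_prefix[of "[a1, s, a2]" "[y]"] P(1) by simp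
    then show ?thesis
      using induced_cycle_append[of "[v]" "[a1, s, a2]"] v nadj P(2) disjoint by auto
  qed
  have cross: "(x, u) \<in> A \<longleftrightarrow> x = s \<and> u = w \<or> x = a2 \<and> u = y"
    if x: "x \<in> {a1, s, a2}" and u: "u \<in> insert y ({w, q} \<union> H)" for x u
  proof -
    from u consider "u = y" | "u = w" | "u = q" "q \<noteq> w" | "u \<in> H" by blast
    then show ?thesis
    proof cases
      case 1
      then show ?thesis using x adj dist P(2) w disjoint by auto
    next
      case 2
      then show ?thesis using x adj_sym[OF w(2)] nadj adj_commute[of x w] dist P(2) w disjoint by auto
    next
      case 3
      then show ?thesis using x qw q(3) nadj adj_commute[of x q] dist P(2) q disjoint by auto
    next
      case 4
      then show ?thesis using X_H[of x u] x P(2) w disjoint by auto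
    qed
  qed
  have dj: "insert y ({w, q} \<union> H) \<inter> {v, a1, s, a2} = {}"
    using P(2) dist disjoint w q v \<open>v \<noteq> w\<close> \<open>v \<noteq> q\<close> by auto
  have yH: "y \<notin> {w, q} \<union> H" using P(2) disjoint w q by auto
  from link[OF v(1) w(1) q(1) \<open>v \<noteq> w\<close> \<open>v \<noteq> q\<close>] consider
    (Z) Z p where "connected_set A Z" "w \<in> Z" "q \<in> Z" "Z \<subseteq> {w, q} \<union> H" "p \<in> Z"
      "\<forall>y\<in>Z. (v, y) \<in> A \<longleftrightarrow> y = p"
  | (Q) Q z1 z2 where "induced_path A Q" "hd Q = w" "last Q = q" "set Q \<subseteq> {w, q} \<union> H"
      "z1 \<in> set Q" "z2 \<in> set Q" "z1 \<noteq> z2" "\<forall>y\<in>set Q. (v, y) \<in> A \<longleftrightarrow> y = z1 \<or> y = z2"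
    by blast
  then have "has_isk4 A"
  proof cases
    case Z
    have vZ: "(v, u) \<in> A \<longleftrightarrow> u = p" if "u \<in> insert y Z" for u
      using that Z(4-6) nadj(2) yH by blast
    show ?thesis
    proof (rule isk4_of_attachments[of _ v "[a1]" s "[]" a2 "[]" "insert y Z" p w y, OF refl cyc])
      show "connected_set A (insert y Z)" using connected_set_insert Z(1,3) q(2) by blast
      show "insert y Z \<inter> set (v # [a1] @ s # [] @ a2 # []) = {}" using dj Z(4) by auto
      fix x u assume xu: "x \<in> set (v # [a1] @ s # [] @ a2 # [])" "u \<in> insert y Z"
      then have "x = v \<or> x \<in> {a1, s, a2}" "u \<in> insert y ({w, q} \<union> H)" using Z(4) by auto
      moreover have "v \<noteq> s" "v \<noteq> a2" "v \<noteq> a1" using P(2) v(1) disjoint by auto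
      ultimately show "(x, u) \<in> A \<longleftrightarrow> x = v \<and> u = p \<or> x = s \<and> u = w \<or> x = a2 \<and> u = y"
        using cross[of x u] vZ[OF xu(2)] by auto
    qed (use Z in auto)
  next
    case Q
    have Q0: "Q \<noteq> []" using Q(1) by (simp add: induced_path_def)
    \<comment> \<open>Only the last vertex \<open>q\<close> of \<open>Q\<close> sees
      \<open>y\<close>, so appending \<open>y\<close> gives an induced path whose ends are attached
      at \<open>s\<close> and \<open>a2\<close>.\<close>
    have "(u, y) \<in> A \<longleftrightarrow> u = q" if "u \<in> set Q" for u
      using that Q(4) q(2) qw X_H[of y u] adj_commute[of u y] P(2) by blast
    then have Qy: "induced_path A (Q @ [y])"
      using Q(1,3,4) Q0 yH by (subst induced_path_append) auto
    show ?thesis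
    proof (rule isk4_of_two_neighbours[OF refl cyc _ Qy _ _ _ _ Q(7)])
      show "set (Q @ [y]) \<inter> set (v # [a1] @ s # [] @ a2 # []) = {}" using dj Q(4) by auto
      fix x u assume "x \<in> set (v # [a1] @ s # [] @ a2 # []) - {v}" "u \<in> set (Q @ [y])"
      then have "x \<in> {a1, s, a2}" "u \<in> insert y ({w, q} \<union> H)" using Q(4) by auto
      then show "(x, u) \<in> A \<longleftrightarrow> x = s \<and> u = hd (Q @ [y]) \<or> x = a2 \<and> u = last (Q @ [y])"
        using cross[of x u] Q(2) Q0 by simp
    next
      fix u assume "u \<in> set (Q @ [y])"
      then show "(v, u) \<in> A \<longleftrightarrow> u = z1 \<or> u = z2"
        using Q(4-6,8) nadj(2) yH by auto
    qed (use Q in auto)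
  qed
  with isk4_free show False ..
qed

lemma no_square_on_long_cycle:
  assumes cyc: "induced_cycle A (a1 # s # a2 # J)" "set (a1 # s # a2 # J) \<subseteq> X" "2 \<le> length J"
    and v: "v \<in> W" "(v, a1) \<in> A" "(v, a2) \<in> A"
  shows False
proof -
  obtain y J' where J': "J = y # J'" "J' \<noteq> []" using cyc(3) by (cases J rule: remdups_adj.cases) auto
  obtain J'' x where J'': "J = J'' @ [x]" "J'' \<noteq> []"
    using cyc(3) by (cases J rule: rev_cases) fastforce+
  have py: "induced_path A [a1, s, a2, y]"
    using cyc(1) J' induced_cycle_append[of "[a1, s, a2, y]" J'] by simp
  have "induced_cycle A ([x] @ (a1 # s # a2 # J''))"
    by (rule induced_cycle_rotate) (use cyc(1) J'' in simp)
  then have "induced_path A [x, a1, s, a2]"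
    using J'' induced_cycle_append[of "[x, a1, s, a2]" J''] by simp
  \<comment> \<open>Reversed, so that the same lemma applies to \<open>x\<close> with
    \<open>a1\<close> and \<open>a2\<close> exchanged.\<close>
  then have px: "induced_path A [a2, s, a1, x]"
    using induced_path_rev[of "[x, a1, s, a2]"] by simp
  have X: "{a1, s, a2, y} \<subseteq> X" "{a2, s, a1, x} \<subseteq> X" using cyc(2) J'(1) arg_cong[OF J''(1), of set] by auto
  have adj: "(a1, s) \<in> A" "(s, a2) \<in> A" "(a2, y) \<in> A" "(a1, a2) \<notin> A" "(a1, y) \<notin> A" "(s, y) \<notin> A"
    and dist: "distinct [a1, s, a2, y]"
    using py by (auto simp: induced_path_Cons)
  have adjx: "(a1, x) \<in> A" using px by (auto simp: induced_path_Cons)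
  \<comment> \<open>The instance \<open>q = w\<close>; its condition that \<open>q\<close> misses
    \<open>a1\<close> holds because \<open>w\<close>, \<open>a1\<close>, \<open>s\<close> is not a
    triangle.\<close>
  have wy: "(w, y) \<notin> A" if "w \<in> W" "(w, s) \<in> A" for w
    using no_parent_beyond_square[OF py X(1) v that that(1)] no_triangle[of w a1 s] that(2) adj(1)
    by blast
  have wx: "(w, x) \<notin> A" if "w \<in> W" "(w, s) \<in> A" for w
    using no_parent_beyond_square[OF px X(2) v(1,3,2) that that(1)] no_triangle[of w s a2] that(2) adj(2)
    by blast
  obtain w where w: "w \<in> W" "(w, s) \<in> A" using parent[of s] X adj_sym by blast
  obtain q where q: "q \<in> W" "(q, y) \<in> A" using parent[of y] X adj_sym by blast
  obtain p where p: "p \<in> W" "(p, x) \<in> A" using parent[of x] X adj_sym by blast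
  have qa1: "(q, a1) \<in> A"
    using no_parent_beyond_square[OF py X(1) v w q] wy w q by blast
  have pa2: "(p, a2) \<in> A"
    using no_parent_beyond_square[OF px X(2) v(1,3,2) w p] wx w p by blast
  have nq: "(q, s) \<notin> A" "(q, a2) \<notin> A" using no_triangle[of q a1 s] no_triangle[of q a2 y] qa1 q adj by auto
  have np: "(p, a1) \<notin> A" "(p, s) \<notin> A" "(p, y) \<notin> A"
    using no_triangle[of p a1 x] no_triangle[of p s a2] no_triangle[of p a2 y] pa2 p adj adjx by auto
  have nw: "(w, a1) \<notin> A" "(w, a2) \<notin> A" "(w, y) \<notin> A"
    using no_triangle[of w a1 s] no_triangle[of w s a2] w adj wy by auto
  \<comment> \<open>In this pentagon \<open>q\<close> takes the role of \<open>v\<close>. On the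
    other four vertices \<open>w\<close> sees only \<open>s\<close>, and \<open>p\<close>, the
    parent of \<open>x\<close>, sees only \<open>a2\<close>.\<close>
  have cyc': "induced_cycle A (q # [a1] @ s # [] @ a2 # [y])"
    using induced_cycle_append[of "[q]" "[a1, s, a2, y]"] py q qa1 nq X disjoint by auto
  show False
  proof (rule no_two_private_neighbours[OF cyc', of w p])
    show "(u, w) \<in> A \<longleftrightarrow> u = s" if "u \<in> set ([a1] @ s # [] @ a2 # [y])" for u
      using that w nw adj_commute[of u w] by auto
    show "(u, p) \<in> A \<longleftrightarrow> u = a2" if "u \<in> set ([a1] @ s # [] @ a2 # [y])" for u
      using that pa2 np adj_commute[of u p] by auto
  qed (use X w p q nq qa1 np nw in auto)
qed

text \<open>Parents of three cycle vertices together with their descents to \<open>r\<close> form a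
  connected set. The earlier layers send no edges to the cycle and no parent sees two of its
  vertices, so there are exactly three attachments.\<close>

lemma no_three_private_neighbours:
  assumes cyc: "induced_cycle A (c1 # c2 # c3 # J)" "set (c1 # c2 # c3 # J) \<subseteq> X"
    and priv: "\<And>w u u'. w \<in> W \<Longrightarrow> u \<in> set (c1 # c2 # c3 # J) \<Longrightarrow> u' \<in> set (c1 # c2 # c3 # J) \<Longrightarrow>
      (w, u) \<in> A \<Longrightarrow> (w, u') \<in> A \<Longrightarrow> u = u'"
  shows False
proof -
  obtain p1 where p1: "p1 \<in> W" "(p1, c1) \<in> A" using parent[of c1] cyc adj_sym by auto
  obtain p2 where p2: "p2 \<in> W" "(p2, c2) \<in> A" using parent[of c2] cyc adj_sym by auto
  obtain p3 where p3: "p3 \<in> W" "(p3, c3) \<in> A" using parent[of c3] cyc adj_sym by auto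
  have up: "\<exists>U. U \<subseteq> H \<and> r \<in> U \<and> connected_set A (insert w U)" if w: "w \<in> W" for w
  proof -
    obtain U u where "U \<subseteq> H" "connected_set A U" "r \<in> U" "u \<in> U" "(w, u) \<in> A"
      using upset[OF w] by auto
    then show ?thesis using connected_set_insert[of U u w] adj_sym by blast
  qed
  obtain U1 where U1: "U1 \<subseteq> H" "r \<in> U1" "connected_set A (insert p1 U1)" using up p1 by blast
  obtain U2 where U2: "U2 \<subseteq> H" "r \<in> U2" "connected_set A (insert p2 U2)" using up p2 by blast
  obtain U3 where U3: "U3 \<subseteq> H" "r \<in> U3" "connected_set A (insert p3 U3)" using up p3 by blast
  define Z where "Z = insert p1 U1 \<union> insert p2 U2 \<union> insert p3 U3"
  have "connected_set A (insert p1 U1 \<union> insert p2 U2)"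
    by (rule connected_set_Un[OF U1(3) U2(3), of r r]) (use U1 U2 in auto)
  then have Zc: "connected_set A Z"
    unfolding Z_def by (rule connected_set_Un[OF _ U3(3), of _ r r]) (use U1 U3 in auto)
  have ZH: "Z \<subseteq> {p1, p2, p3} \<union> H" using U1 U2 U3 by (auto simp: Z_def)
  have d: "c1 \<noteq> c2" "c1 \<noteq> c3" "c2 \<noteq> c3" using cyc(1) by (auto simp: induced_cycle_def)
  have pd: "p1 \<noteq> p2" "p1 \<noteq> p3" "p2 \<noteq> p3"
    using priv[of p1 c1 c2] priv[of p1 c1 c3] priv[of p2 c2 c3] d p1 p2 p3 by auto
  have pH: "p1 \<notin> H" "p2 \<notin> H" "p3 \<notin> H" using p1 p2 p3 disjoint by auto
  have "has_isk4 A"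
  proof (rule isk4_of_attachments[of "c1 # c2 # c3 # J" c1 "[]" c2 "[]" c3 J Z p1 p2 p3])
    show "Z \<inter> set (c1 # c2 # c3 # J) = {}" using ZH cyc(2) p1 p2 p3 disjoint by blast
    fix x y assume x: "x \<in> set (c1 # c2 # c3 # J)" and y: "y \<in> Z"
    have nbr: "(x, p) \<in> A \<longleftrightarrow> x = c"
      if "p \<in> W" "(p, c) \<in> A" "c \<in> set (c1 # c2 # c3 # J)" for p c
      using priv[OF that(1) x that(3)] that(2) adj_sym by blast
    have "(x, p1) \<in> A \<longleftrightarrow> x = c1" "(x, p2) \<in> A \<longleftrightarrow> x = c2" "(x, p3) \<in> A \<longleftrightarrow> x = c3"
      using nbr[OF p1] nbr[OF p2] nbr[OF p3] by simp_all
    moreover have "y \<in> H \<Longrightarrow> (x, y) \<notin> A" using X_H x cyc(2) by blast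
    moreover have "y = p1 \<or> y = p2 \<or> y = p3 \<or> y \<in> H" using y ZH by blast
    ultimately show "(x, y) \<in> A \<longleftrightarrow> x = c1 \<and> y = p1 \<or> x = c2 \<and> y = p2 \<or> x = c3 \<and> y = p3"
      using pd pH by blast
  qed (use cyc Zc in \<open>auto simp: Z_def\<close>)
  with isk4_free show False ..
qed

theorem no_long_induced_cycle:
  assumes "induced_cycle A C" "set C \<subseteq> X" "5 \<le> length C"
  shows False
proof -
  \<comment> \<open>All induced cycles of length at least five in \<open>X\<close> compete here, not
    only \<open>C\<close>. Each is written starting at \<open>a1\<close>, so that \<open>I\<close>
    is the interior of an arc whose ends have the common parent \<open>v\<close>; the length of
    \<open>I\<close> is minimised.\<close>
  define P where "P = (\<lambda>(v, a1, I, a2, J). v \<in> W \<and> induced_cycle A (a1 # I @ a2 # J)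
    \<and> set (a1 # I @ a2 # J) \<subseteq> X \<and> 5 \<le> length (a1 # I @ a2 # J) \<and> (v, a1) \<in> A \<and> (v, a2) \<in> A)"
  have PI: "P (w, u, B2, u', B3 @ B1) \<and> P (w, u', B3 @ B1, u, B2)"
    if "induced_cycle A (B1 @ u # B2 @ u' # B3)" "set (B1 @ u # B2 @ u' # B3) \<subseteq> X"
      "5 \<le> length (B1 @ u # B2 @ u' # B3)" "w \<in> W" "(w, u) \<in> A" "(w, u') \<in> A" for w u u' B1 B2 B3
    using induced_cycle_rotate[of B1 "u # B2 @ u' # B3"]
      induced_cycle_rotate[of "B1 @ u # B2" "u' # B3"] that by (auto simp: P_def)
  show False
  proof (cases "\<exists>t. P t")
    case False
    obtain c1 c2 c3 J where C: "C = c1 # c2 # c3 # J"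
      using assms(3) by (cases C; cases "tl C"; cases "tl (tl C)") auto
    show False
    proof (rule no_three_private_neighbours[of c1 c2 c3 J])
      fix w u u' assume w: "w \<in> W" "u \<in> set (c1 # c2 # c3 # J)" "u' \<in> set (c1 # c2 # c3 # J)"
        "(w, u) \<in> A" "(w, u') \<in> A"
      show "u = u'"
      proof (rule ccontr)
        assume "u \<noteq> u'"
        with w obtain x x' B1 B2 B3 where "C = B1 @ x # B2 @ x' # B3" "{x, x'} = {u, u'}"
          unfolding C by (metis split_list_two)
        moreover from this have "(w, x) \<in> A" "(w, x') \<in> A" using w by (auto simp: doubleton_eq_iff)
        ultimately show False using PI[of B1 x B2 x' B3 w] assms w(1) False by blast
      qed
    qed (use assms C in auto)
  next
    case True
    then obtain t where "P t" and min: "\<And>t'. P t' \<Longrightarrow> length (fst (snd (snd t))) \<le> length (fst (snd (snd t')))"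
      using ex_has_least_nat[of P _ "\<lambda>t. length (fst (snd (snd t)))"] by metis
    moreover obtain v a1 I a2 J where "t = (v, a1, I, a2, J)" by (cases t)
    ultimately have t: "v \<in> W" "induced_cycle A (a1 # I @ a2 # J)" "set (a1 # I @ a2 # J) \<subseteq> X"
      "5 \<le> length (a1 # I @ a2 # J)" "(v, a1) \<in> A" "(v, a2) \<in> A"
      and min: "\<And>v' b1 I' b2 J'. P (v', b1, I', b2, J') \<Longrightarrow> length I \<le> length I'"
      by (auto simp: P_def)
    let ?S = "a1 # I @ [a2]"
    \<comment> \<open>Two vertices of the arc other than its pair of ends enclose a shorter arc of
      the same cycle, so by minimality they have no common parent.\<close>
    have uniq: "{u, u'} = {a1, a2}"
      if w: "w \<in> W" "(w, u) \<in> A" "(w, u') \<in> A" and u: "u \<in> set ?S" "u' \<in> set ?S" "u \<noteq> u'" for w u u'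
    proof -
      obtain x x' B1 B2 B3 where B: "?S = B1 @ x # B2 @ x' # B3" "{x, x'} = {u, u'}"
        using u by (metis split_list_two)
      have eq: "a1 # I @ a2 # J = B1 @ x # B2 @ x' # (B3 @ J)"
        using arg_cong[OF B(1), of "\<lambda>l. l @ J"] by simp
      have "(w, x) \<in> A" "(w, x') \<in> A" using w B(2) by (auto simp: doubleton_eq_iff)
      then have "length I \<le> length B2"
        using PI[of B1 x B2 x' "B3 @ J" w] t(2-4) w(1) unfolding eq by (blast dest: min)
      moreover have "length ?S = length (B1 @ x # B2 @ x' # B3)" using B(1) by simp
      ultimately have "B1 = []" "B3 = []" by auto
      then have "x = a1" "x' = a2" using B(1) by auto
      with B(2) show ?thesis by auto
    qed
    have dS: "distinct ?S" using t(2) by (auto simp: induced_cycle_def)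
    have vI: "(v, u) \<notin> A" if "u \<in> set I" for u
      using uniq[of v a1 u] t(1,5) that dS by (auto simp: doubleton_eq_iff)
    have J0: "J \<noteq> []"
    proof
      assume "J = []"
      with t(2) have "(a2, a1) \<in> A"
        using induced_cycle_cross[of "a1 # I" "[a2]" a1 a2] adj_commute[of a1 a2] by simp
      with t(5,6) no_triangle[of v a2 a1] show False by blast
    qed
    have S: "induced_path A ?S" using t(2) J0 induced_cycle_append[of ?S J] by simp
    consider "I = []" | s where "I = [s]" | s1 s2 I' where "I = s1 # s2 # I'"
      by (cases I rule: remdups_adj.cases) auto
    then show False
    proof cases
      case 1
      then have "(a1, a2) \<in> A" using S by (simp add: induced_path_Cons)
      with t(5,6) no_triangle[of v a1 a2] show False by blast
    next
      case (2 s)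
      then show False using no_square_on_long_cycle[of a1 s a2 J v] t by simp
    next
      case (3 s1 s2 I')
      \<comment> \<open>The rest \<open>J\<close> of the long cycle is replaced by \<open>v\<close>.
        On the new cycle the inner vertices \<open>s1\<close> and \<open>s2\<close> have private
        parents by \<open>uniq\<close>.\<close>
      have "induced_cycle A ([v] @ ?S)"
      proof (subst induced_cycle_append)
        have "(v, y) \<in> A \<longleftrightarrow> y = a1 \<or> y = a2" if "y \<in> set ?S" for y
          using that t(5,6) vI by auto
        moreover have "v \<notin> set ?S" using t(1,3) disjoint by auto
        ultimately show "3 \<le> length [v] + length ?S \<and> induced_path A [v] \<and> induced_path A ?S \<and>
          set [v] \<inter> set ?S = {} \<and> (\<forall>x\<in>set [v]. \<forall>y\<in>set ?S.
           ((x, y) \<in> A) = (x = last [v] \<and> y = hd ?S \<or> x = hd [v] \<and> y = last ?S))"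
          using S 3 by simp
      qed auto
      then have cyc: "induced_cycle A (v # [a1] @ s1 # [] @ s2 # (I' @ [a2]))" using 3 by simp
      obtain w1 where w1: "w1 \<in> W" "(w1, s1) \<in> A" using parent[of s1] t(3) 3 adj_sym by auto
      obtain w2 where w2: "w2 \<in> W" "(w2, s2) \<in> A" using parent[of s2] t(3) 3 adj_sym by auto
      have S_eq: "set ([a1] @ s1 # [] @ s2 # (I' @ [a2])) = set ?S" using 3 by auto
      show False
      proof (rule no_two_private_neighbours[OF cyc, of w1 w2])
        fix x assume "x \<in> set ([a1] @ s1 # [] @ s2 # (I' @ [a2]))"
        then have x: "x \<in> set ?S" by (simp only: S_eq)
        show "(x, w1) \<in> A \<longleftrightarrow> x = s1"
          using uniq[OF w1(1), of x s1] x w1 3 dS adj_commute[of x w1] by (auto simp: doubleton_eq_iff)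
        show "(x, w2) \<in> A \<longleftrightarrow> x = s2"
          using uniq[OF w2(1), of x s2] x w2 3 dS adj_commute[of x w2] by (auto simp: doubleton_eq_iff)
      next
        show "set ([a1] @ s1 # [] @ s2 # I' @ [a2]) \<subseteq> X" using t(3) 3 by auto
        show "w1 \<noteq> v" "w2 \<noteq> v" using w1 w2 vI 3 by auto
      qed (use w1 w2 t in auto)
    qed
  qed
qed

end

section \<open>Odd closed walks and the colouring\<close>

lemma path_arcs_map_upt:
  "path_arcs (map f [0..<Suc n]) = (\<Union>i<n. {(f i, f (Suc i)), (f (Suc i), f i)})"
proof (induction n)
  case (Suc n)
  have "map f [0..<Suc (Suc n)] = map f [0..<n] @ f n # [f (Suc n)]" by simp
  also have "path_arcs \<dots>
      = path_arcs (map f [0..<n] @ [f n]) \<union> {(f n, f (Suc n)), (f (Suc n), f n)}"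
    by (subst path_arcs_append_Cons) simp
  also have "map f [0..<n] @ [f n] = map f [0..<Suc n]" by simp
  finally show ?case unfolding Suc.IH lessThan_Suc by blast
qed simp

lemma relpow_sym:
  assumes "sym B" "(x, y) \<in> B ^^ n"
  shows "(y, x) \<in> B ^^ n"
  using assms(2)
proof (induction n arbitrary: y)
  case (Suc n)
  then obtain z where "(x, z) \<in> B ^^ n" "(z, y) \<in> B" by auto
  then show ?case using Suc.IH assms(1) by (meson relpow_Suc_I2 symD)
qed simp

lemma relpow_trans: "(x, y) \<in> B ^^ m \<Longrightarrow> (y, z) \<in> B ^^ n \<Longrightarrow> (x, z) \<in> B ^^ (m + n)"
  by (auto simp: relpow_add)

text \<open>The colour is the parity of a walk to a representative of the component. Walks of equal
  parity from both ends of an edge would close up with this edge to an odd closed walk.\<close>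

lemma two_colouring_of_no_odd_closed_walk:
  assumes "sym B" and odd: "\<And>x n. odd n \<Longrightarrow> (x, x) \<notin> B ^^ n"
  shows "\<exists>c :: 'a \<Rightarrow> bool. \<forall>x y. (x, y) \<in> B \<longrightarrow> c x \<noteq> c y"
proof -
  define rep where "rep x = (SOME y. (x, y) \<in> B\<^sup>*)" for x
  define c where "c x \<longleftrightarrow> (\<exists>n. even n \<and> (x, rep x) \<in> B ^^ n)" for x
  have rep: "(x, rep x) \<in> B\<^sup>*" for x
    unfolding rep_def by (rule someI[of _ x]) simp
  have "c x \<noteq> c y" if xy: "(x, y) \<in> B" for x y
  proof
    assume eq: "c x = c y"
    have yx: "(y, x) \<in> B" using assms(1) xy by (meson symD)
    have "(x, z) \<in> B\<^sup>* \<longleftrightarrow> (y, z) \<in> B\<^sup>*" for z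
      using xy yx by (meson converse_rtrancl_into_rtrancl)
    then have same: "rep y = rep x" by (simp add: rep_def)
    \<comment> \<open>If \<open>c x\<close> holds, an even walk is taken; otherwise any walk to the
      representative is odd.\<close>
    obtain m where m: "(x, rep x) \<in> B ^^ m" "even m \<longleftrightarrow> c x"
      using rep[of x] rtrancl_power[of "(x, rep x)" B] unfolding c_def by blast
    obtain n where n: "(y, rep x) \<in> B ^^ n" "even n \<longleftrightarrow> c y"
      using rep[of y] rtrancl_power[of "(y, rep y)" B] same unfolding c_def by metis
    have "(x, x) \<in> B ^^ (m + (n + 1))"
      using m(1) relpow_sym[OF assms(1) n(1)] yx by (intro relpow_trans) auto
    moreover have "odd (m + (n + 1))" using m(2) n(2) eq by auto
    ultimately show False using odd by blast
  qed
  then show ?thesis by blast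
qed

context triangle_free_graph begin

text \<open>A shortest odd closed walk is an induced cycle: a repeated vertex or a chord splits it
  into two closed walks, one of which is odd and shorter.\<close>

lemma odd_induced_cycle_of_odd_closed_walk:
  assumes "(x0, x0) \<in> (Restr A X) ^^ n0" "odd n0"
  shows "\<exists>C. induced_cycle A C \<and> set C \<subseteq> X \<and> odd (length C)"
proof -
  let ?B = "Restr A X"
  define P where "P n \<longleftrightarrow> odd n \<and> (\<exists>x. (x, x) \<in> ?B ^^ n)" for n
  define n where "n = (LEAST n. P n)"
  have "P n0" using assms by (auto simp: P_def)
  then have "P n" unfolding n_def by (rule LeastI)
  have min: "n \<le> m" if "odd m" "(x, x) \<in> ?B ^^ m" for m x
    unfolding n_def using that by (intro Least_le) (auto simp: P_def)
  have "odd n" using \<open>P n\<close> by (simp add: P_def)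
  obtain f where f: "f n = f 0" "\<And>i. i < n \<Longrightarrow> (f i, f (Suc i)) \<in> ?B"
    using \<open>P n\<close> unfolding P_def relpow_fun_conv by metis
  have fX: "f i \<in> X" if "i < n" for i using f(2)[OF that] by auto
  have seg: "(f i, f j) \<in> ?B ^^ (j - i)" if "i \<le> j" "j \<le> n" for i j
    unfolding relpow_fun_conv using that f(2) by (intro exI[of _ "\<lambda>k. f (i + k)"]) auto
  \<comment> \<open>The other way round, from \<open>f j\<close> through \<open>f n = f 0\<close> to
    \<open>f i\<close>.\<close>
  have wrap: "(f j, f i) \<in> ?B ^^ (n - j + i)" if "i \<le> j" "j \<le> n" for i j
    using relpow_trans[OF seg[of j n]] seg[of 0 i] f(1) that by auto
  have inj: "f i \<noteq> f j" if "i < j" "j < n" for i j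
  proof
    assume eq: "f i = f j"
    have "odd (j - i) \<or> odd (n - j + i)" using \<open>odd n\<close> that by auto
    moreover have "(f i, f i) \<in> ?B ^^ (j - i)" "(f i, f i) \<in> ?B ^^ (n - j + i)"
      using seg[of i j] wrap[of i j] that eq by auto
    ultimately have "n \<le> j - i \<or> n \<le> n - j + i" using min by blast
    then show False using that by auto
  qed
  \<comment> \<open>The two closed walks through the chord have total length \<open>n + 2\<close>,
    so one is odd and by minimality at least \<open>n\<close> long; the other then has length at
    most two, that is, the chord is an edge of the walk.\<close>
  have chord: "j = Suc i \<or> i = 0 \<and> Suc j = n" if "i < j" "j < n" "(f i, f j) \<in> A" for i j
  proof -
    have adj: "(f i, f j) \<in> ?B" "(f j, f i) \<in> ?B" using that fX adj_sym by auto
    have "(f i, f i) \<in> ?B ^^ (j - i + 1)" "(f j, f j) \<in> ?B ^^ (n - j + i + 1)"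
      using relpow_trans[OF seg[of i j], of "f i" 1] relpow_trans[OF wrap[of i j], of "f j" 1] adj that
      by auto
    moreover have "odd (j - i + 1) \<or> odd (n - j + i + 1)" using \<open>odd n\<close> that by auto
    ultimately have "n \<le> j - i + 1 \<or> n \<le> n - j + i + 1" using min by blast
    then show ?thesis using that by auto
  qed
  have "n \<noteq> 1" using f adj_irrefl[of "f 0"] by auto
  then have "3 \<le> n" using \<open>odd n\<close> by presburger
  define C where "C = map f [0..<n]"
  have "set C = f ` {..<n}" by (auto simp: C_def)
  have "C @ [hd C] = map f [0..<Suc n]"
    using \<open>3 \<le> n\<close> f(1) by (simp add: C_def hd_map)
  then have arcs: "path_arcs (C @ [hd C]) = (\<Union>i<n. {(f i, f (Suc i)), (f (Suc i), f i)})"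
    by (simp only: path_arcs_map_upt)
  have "Restr A (set C) = path_arcs (C @ [hd C])"
  proof
    show "Restr A (set C) \<subseteq> path_arcs (C @ [hd C])"
    proof clarify
      fix u w assume "(u, w) \<in> A" "u \<in> set C" "w \<in> set C"
      then obtain i j where ij: "i < n" "j < n" "u = f i" "w = f j" "(f i, f j) \<in> A"
        by (auto simp: C_def)
      have edge: "{(f i, f j), (f j, f i)} \<subseteq> path_arcs (C @ [hd C])" if "i < j" "j < n" "(f i, f j) \<in> A" for i j
        using chord[OF that]
      proof
        assume "j = Suc i"
        then show ?thesis unfolding arcs using that by auto
      next
        assume *: "i = 0 \<and> Suc j = n"
        then have "f i = f (Suc j)" using f(1) by simp
        then show ?thesis unfolding arcs using that by auto
      qed
      have "i \<noteq> j" using ij(5) adj_irrefl by auto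
      then show "(u, w) \<in> path_arcs (C @ [hd C])"
        using edge[of i j] edge[of j i] ij adj_sym by (cases "i < j") auto
    qed
    have "(f i, f (Suc i)) \<in> Restr A (set C)" if "i < n" for i
    proof -
      have "f (Suc i) \<in> set C"
        using that f(1) \<open>3 \<le> n\<close> by (cases "Suc i = n") (auto simp: C_def)
      then show ?thesis using f(2)[OF that] that by (auto simp: C_def)
    qed
    then show "path_arcs (C @ [hd C]) \<subseteq> Restr A (set C)"
      unfolding arcs using adj_sym by blast
  qed
  moreover have "distinct C"
    unfolding C_def distinct_map using inj by (auto simp: inj_on_def) (metis linorder_neqE_nat)
  ultimately have "induced_cycle A C" using \<open>3 \<le> n\<close> by (simp add: induced_cycle_def C_def)
  then show ?thesis using \<open>odd n\<close> fX by (intro exI[of _ C]) (auto simp: C_def)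
qed

lemma induced_cycle_length_neq_3:
  assumes "induced_cycle A C"
  shows "length C \<noteq> 3"
proof
  assume "length C = 3"
  then obtain a b c where "C = [a, b, c]"
    by (auto simp: numeral_3_eq_3 length_Suc_conv)
  with assms have "Restr A (set C) = {(a, b), (b, a), (b, c), (c, b), (c, a), (a, c)}"
    by (auto simp: induced_cycle_def)
  then have "(a, b) \<in> A" "(b, c) \<in> A" "(a, c) \<in> A" by blast+
  with no_triangle show False by blast
qed

section \<open>Distance layers of the components\<close>

definition component_root :: "'a \<Rightarrow> 'a" where
  "component_root x = (SOME y. (x, y) \<in> A\<^sup>*)"

definition level :: "'a \<Rightarrow> nat" where
  "level x = (LEAST n. (x, component_root x) \<in> A ^^ n)"

text \<open>Adjacent vertices reach the same vertices, so \<open>SOME\<close> chooses from the same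
  predicate for both; each component gets a single root.\<close>

lemma component_root_cong:
  assumes "(x, y) \<in> A"
  shows "component_root x = component_root y"
proof -
  have "(x, z) \<in> A\<^sup>* \<longleftrightarrow> (y, z) \<in> A\<^sup>*" for z
    using assms adj_sym by (meson converse_rtrancl_into_rtrancl)
  then show ?thesis by (simp add: component_root_def)
qed

lemma level_relpow: "(x, component_root x) \<in> A ^^ level x"
proof -
  have "(x, component_root x) \<in> A\<^sup>*" unfolding component_root_def by (rule someI[of _ x]) simp
  then obtain n where "(x, component_root x) \<in> A ^^ n" using rtrancl_power by blast
  then show ?thesis unfolding level_def by (rule LeastI)
qed

lemma level_le: "(x, component_root x) \<in> A ^^ n \<Longrightarrow> level x \<le> n"
  unfolding level_def by (rule Least_le)

lemma level_adj: "(x, y) \<in> A \<Longrightarrow> level x \<le> Suc (level y)"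
  using level_relpow[of y] component_root_cong[of x y] by (intro level_le) (metis relpow_Suc_I2)

lemma level_0: "level x = 0 \<Longrightarrow> x = component_root x"
  using level_relpow[of x] by simp

lemma level_parent:
  assumes "level x = Suc n"
  obtains y where "(x, y) \<in> A" "level y = n"
proof -
  obtain y where y: "(x, y) \<in> A" "(y, component_root x) \<in> A ^^ n"
    using level_relpow[of x] assms by (metis relpow_Suc_D2)
  then have "level y \<le> n" using component_root_cong[OF y(1)] by (intro level_le) simp
  with level_adj[OF y(1)] assms y(1) show thesis by (intro that[of y]) auto
qed

text \<open>The set collects a descent to the root with one vertex per step. That \<open>w\<close>
  is alone on the top level yields the uniqueness clause of \<open>upset\<close> in
  \<open>layered_graph\<close>.\<close>

lemma level_upset:
  "\<exists>U. connected_set A U \<and> w \<in> U \<and> component_root w \<in> U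
    \<and> (\<forall>x\<in>U. component_root x = component_root w \<and> level x \<le> level w \<and> (level x = level w \<longrightarrow> x = w))"
proof (induction "level w" arbitrary: w)
  case 0
  then show ?case using level_0[of w] by (intro exI[of _ "{w}"]) (auto simp: connected_set_def)
next
  case (Suc n)
  obtain y where y: "(w, y) \<in> A" "level y = n" using level_parent[of w n] Suc(2) by auto
  obtain U where U: "connected_set A U" "y \<in> U" "component_root y \<in> U"
    "\<forall>x\<in>U. component_root x = component_root y \<and> level x \<le> level y \<and> (level x = level y \<longrightarrow> x = y)"
    using Suc(1)[OF y(2)[symmetric]] by blast
  have "connected_set A (insert w U)"
    using connected_set_insert[OF U(1,2)] y(1) adj_sym by blast
  then show ?case
    using U y component_root_cong[OF y(1)] Suc(2) by (intro exI[of _ "insert w U"]) fastforce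
qed

text \<open>From \<open>2 \<le> k\<close> on, a vertex of level \<open>k - 1\<close> is not the
  root, so it has a neighbour \<open>u\<close> on level \<open>k - 2\<close>. Vertices of level
  \<open>k - 1\<close> have no neighbours below level \<open>k - 2\<close>, hence in the descent
  from \<open>u\<close> they can see only \<open>u\<close>.\<close>

lemma layered_graph_level:
  assumes "\<not> has_isk4 A" "2 \<le> k"
  shows "layered_graph A {x. component_root x = \<rho> \<and> level x = k} {x. component_root x = \<rho> \<and> Suc (level x) = k}
    {x. component_root x = \<rho> \<and> Suc (level x) < k} \<rho>" (is "layered_graph A ?X ?W ?H \<rho>")
proof
  show "(x, h) \<notin> A" if "x \<in> ?X" "h \<in> ?H" for x h
    using level_adj[of x h] that by auto
  show "\<exists>w\<in>?W. (x, w) \<in> A" if x: "x \<in> ?X" for x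
  proof -
    have "level x = Suc (k - 1)" using x assms(2) by auto
    then obtain y where "(x, y) \<in> A" "level y = k - 1" by (rule level_parent)
    then show ?thesis using x component_root_cong[of x y] assms(2) by auto
  qed
  show "\<exists>U u. U \<subseteq> ?H \<and> connected_set A U \<and> \<rho> \<in> U \<and> u \<in> U \<and> (w, u) \<in> A
      \<and> (\<forall>v\<in>?W. \<forall>y\<in>U. (v, y) \<in> A \<longrightarrow> y = u)" if w: "w \<in> ?W" for w
  proof -
    have "level w = Suc (k - 2)" using w assms(2) by auto
    then obtain u where u: "(w, u) \<in> A" "level u = k - 2" by (rule level_parent)
    then have ru: "component_root u = \<rho>" using w component_root_cong[of w u] by auto
    obtain U where U: "connected_set A U" "u \<in> U" "component_root u \<in> U"
      "\<And>x. x \<in> U \<Longrightarrow> component_root x = component_root u \<and> level x \<le> level u \<and> (level x = level u \<longrightarrow> x = u)"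
      using level_upset[of u] by blast
    have "y = u" if "v \<in> ?W" "y \<in> U" "(v, y) \<in> A" for v y
      using that level_adj[OF that(3)] U(4)[of y] u(2) assms(2) by auto
    moreover have "U \<subseteq> ?H" using U(4) ru u(2) assms(2) by fastforce
    ultimately show ?thesis using U(1-3) u(1) ru by blast
  qed
qed (use assms(1) in auto)

lemma no_odd_closed_walk_in_level:
  assumes "\<not> has_isk4 A" "odd n"
  shows "(x, x) \<notin> (Restr A {x. component_root x = \<rho> \<and> level x = k}) ^^ n"
proof
  assume "(x, x) \<in> (Restr A {x. component_root x = \<rho> \<and> level x = k}) ^^ n"
  from odd_induced_cycle_of_odd_closed_walk[OF this assms(2)] obtain C
    where C: "induced_cycle A C" "set C \<subseteq> {x. component_root x = \<rho> \<and> level x = k}" "odd (length C)" by blast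
  have "length C \<noteq> 3" "3 \<le> length C"
    using C(1) induced_cycle_length_neq_3 by (auto simp: induced_cycle_def)
  then have len: "5 \<le> length C" using C(3) by presburger
  then obtain a b C' where C': "C = a # b # C'" by (cases C rule: remdups_adj.cases) auto
  then have "(a, b) \<in> Restr A (set C)" using C(1) by (auto simp: induced_cycle_def)
  then have ab: "(a, b) \<in> A" "component_root a = \<rho>" "component_root b = \<rho>" "level a = k" "level b = k" using C(2) by auto
  \<comment> \<open>Levels 0 and 1 lie outside the layered argument: the first is the root alone,
    the second consists of neighbours of the root, which are pairwise nonadjacent.\<close>
  have "k \<noteq> 0" using level_0[of a] level_0[of b] ab adj_irrefl[of a] by metis
  moreover have "k \<noteq> 1"
  proof
    assume "k = 1"
    then obtain a' b' where "(a, a') \<in> A" "level a' = 0" "(b, b') \<in> A" "level b' = 0"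
      using level_parent[of a 0] level_parent[of b 0] ab by (metis One_nat_def)
    moreover from this have "a' = \<rho>" "b' = \<rho>"
      using level_0[of a'] level_0[of b'] component_root_cong[of a a'] component_root_cong[of b b'] ab by auto
    ultimately show False using no_triangle[of a b \<rho>] ab(1) by blast
  qed
  ultimately interpret layered_graph A "{x. component_root x = \<rho> \<and> level x = k}"
    "{x. component_root x = \<rho> \<and> Suc (level x) = k}" "{x. component_root x = \<rho> \<and> Suc (level x) < k}" \<rho>
    by (intro layered_graph_level assms(1)) auto
  show False using no_long_induced_cycle[OF C(1,2) len] .
qed

theorem four_colouring:
  assumes "\<not> has_isk4 A"
  shows "\<exists>c :: 'a \<Rightarrow> nat. (\<forall>x. c x < 4) \<and> (\<forall>x y. (x, y) \<in> A \<longrightarrow> c x \<noteq> c y)"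
proof -
  define d :: "'a \<Rightarrow> nat \<Rightarrow> 'a \<Rightarrow> bool" where
    "d \<rho> k = (SOME c. \<forall>x y. (x, y) \<in> Restr A {x. component_root x = \<rho> \<and> level x = k} \<longrightarrow> c x \<noteq> c y)"
    for \<rho> k
  have "\<exists>c :: 'a \<Rightarrow> bool. \<forall>x y. (x, y) \<in> Restr A {x. component_root x = \<rho> \<and> level x = k} \<longrightarrow> c x \<noteq> c y"
    for \<rho> k
    using no_odd_closed_walk_in_level[OF assms]
    by (intro two_colouring_of_no_odd_closed_walk) (auto simp: sym_def adj_sym)
  then have d: "\<forall>x y. (x, y) \<in> Restr A {x. component_root x = \<rho> \<and> level x = k} \<longrightarrow> d \<rho> k x \<noteq> d \<rho> k y"
    for \<rho> k
    unfolding d_def by (rule someI_ex)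
  \<comment> \<open>Colours 0 and 1 on even levels, 2 and 3 on odd ones; adjacent vertices on
    different levels lie on consecutive levels.\<close>
  define c :: "'a \<Rightarrow> nat" where
    "c x = (if even (level x) then 0 else 2) + (if d (component_root x) (level x) x then 1 else 0)" for x
  have "c x \<noteq> c y" if xy: "(x, y) \<in> A" for x y
  proof (cases "level x = level y")
    case True
    then show ?thesis
      using d[of "component_root x" "level x"] component_root_cong[OF xy] xy by (auto simp: c_def)
  next
    case False
    then have "even (level x) \<longleftrightarrow> odd (level y)"
      using level_adj[OF xy] level_adj[OF adj_sym[OF xy]] by presburger
    then show ?thesis by (auto simp: c_def)
  qed
  moreover have "c x < 4" for x by (simp add: c_def)
  ultimately show ?thesis by blast
qed

end

section \<open>Back to finite graphs and the chromatic number\<close>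

lemma (in pair_graph) induced_subgraph_with_projI:
  assumes "pverts H \<subseteq> pverts G" "parcs H = Restr (parcs G) (pverts H)"
  shows "induced_subgraph (with_proj H) (with_proj G)"
proof (rule induced_subgraphI)
  show "subgraph (with_proj H) (with_proj G)"
    using assms wf_digraph by (auto simp: subgraph_def compatible_def wf_digraph_def)
  show "arcs (with_proj H) = {e \<in> arcs (with_proj G). tail (with_proj G) e \<in> verts (with_proj H)
      \<and> head (with_proj G) e \<in> verts (with_proj H)}"
    using assms by auto
qed

theorem theorem1p7:
  fixes G :: "'a pair_pre_digraph"
  assumes "pair_graph G"
    and "\<not> (\<exists>H :: 'a pair_pre_digraph.
              induced_subgraph (with_proj H) (with_proj G) \<and> K\<^bsub>3\<^esub> (with_proj H))"
    and "\<not> (\<exists>(K :: 'a pair_pre_digraph) (H :: 'a pair_pre_digraph).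
              induced_subgraph (with_proj H) (with_proj G)
              \<and> K\<^bsub>4\<^esub> (with_proj K) \<and> subdivision_pair K H)"
  shows "chromatic_number G \<le> 4"
proof -
  interpret pair_graph G by fact
  interpret triangle_free_graph "parcs G"
  proof
    show sym: "(y, x) \<in> parcs G" if "(x, y) \<in> parcs G" for x y
      using that arcs_symmetric by blast
    show "(x, z) \<notin> parcs G" if xy: "(x, y) \<in> parcs G" and yz: "(y, z) \<in> parcs G" for x y z
    proof
      assume xz: "(x, z) \<in> parcs G"
      define H where "H = \<lparr>pverts = {x, y, z}, parcs = Restr (parcs G) {x, y, z}\<rparr>"
      have d: "x \<noteq> y" "y \<noteq> z" "x \<noteq> z" using xy yz xz no_loops' by blast+
      have "induced_subgraph (with_proj H) (with_proj G)"
        by (rule induced_subgraph_with_projI)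
           (use xy yz in \<open>auto simp: H_def dest: in_arcsD1 in_arcsD2\<close>)
      moreover have "K\<^bsub>3\<^esub> (with_proj H)"
        unfolding complete_digraph_pair_def H_def
        using d xy yz xz sym no_loops' by (auto simp: card_insert_if)
      ultimately show False using assms(2) by blast
    qed
  qed
  have "Field (parcs G) \<subseteq> pverts G"
    by (auto simp: Field_def dest: in_arcsD1 in_arcsD2)
  then have "\<not> has_isk4 (parcs G)"
    using assms(3) induced_subgraph_with_projI unfolding has_isk4_def by (meson subset_trans)
  then obtain c :: "'a \<Rightarrow> nat" where
    "\<forall>x. c x < 4" "\<forall>x y. (x, y) \<in> parcs G \<longrightarrow> c x \<noteq> c y"
    using four_colouring by blast
  then have "proper_colouring G 4 c" by (auto simp: proper_colouring_def)
  then show ?thesis using chromatic_number_le_iff by blast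
qed

end
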